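(* Let $N\ge 3$ be an integer, $0<a<b$ and $A=\{x\in\mathbb{R}^N : a<|x|<b\}$. There exists $\lambda_*>0$ such that, for $\lambda>0$, the problem $$-\Delta u=\lambda(N-2)^2\frac{e^{u(x)}}{|x|^{2(N-1)}}\ (x\in A),\qquad u(x)=0\ (x\in\partial A)$$ admits no radially symmetric solution for $\lambda>\lambda_*$, exactly one radially symmetric solution for $\lambda=\lambda_*$, and exactly two radially symmetric solutions $\underline{u}_\lambda$ and $U_\lambda$ for $0<\lambda<\lambda_*$. Also, as $\lambda\to+0$, $$\lambda\int_A\frac{e^{\underline{u}_\lambda}}{|x|^{2(N-1)}}\,dx\to 0,\qquad \lambda\int_A\frac{e^{U_\lambda}}{|x|^{2(N-1)}}\,dx\to+\infty,$$ and $\underline{u}_\lambda\to 0$ uniformly on $\overline{A}$. Define $\delta_\lambda>0$ by $\lambda\,\delta_\lambda^2\,e^{\|U_\lambda\|_{L^\infty(A)}}=1$ and define $$\tilde U_\lambda(t)=U_\lambda\left(\left(\delta_\lambda t+\frac{a^{2-N}+b^{2-N}}{2}\right)^{\frac{1}{2-N}}\right)-\|U_\lambda\|_{L^\infty(A)},\qquad t\in\tilde I_\lambda=\left(-\frac{a^{2-N}-b^{2-N}}{2\delta_\lambda},\ \frac{a^{2-N}-b^{2-N}}{2\delta_\lambda}\right).$$ Then, as $\lambda\to+0$, $\delta_\lambda\to 0$ and $$\tilde U_\lambda(t)\to U(t)=\log\frac{4e^{\sqrt2\,t}}{(1+e^{\sqrt2\,t})^2}\quad\text{in } C^1_{loc}(\mathbb{R}).$$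 Also, as $\lambda\to+0$, $$\delta_\lambda U_\lambda(|x|)\to 2\sqrt2\,G\left(|x|^{2-N},\,\frac{a^{2-N}+b^{2-N}}{2}\right)$$ uniformly in $C^0(\overline{A})$, where $G(s,t)$ is the Green's function of $-\frac{d^2}{ds^2}$ with the Dirichlet boundary condition on $[\bar a,\bar b]$ with $\bar a=b^{2-N}$, $\bar b=a^{2-N}$.
   Context: For $0<\lambda<\lambda_*$, $\underline{u}_\lambda$ is the minimal (pointwise smaller) radial solution and $U_\lambda$ is the other one. Solutions are understood in the classical sense, $u\in C^2(A)\cap C^0(\overline{A})$; radially symmetric functions are identified with functions of $r=|x|\in[a,b]$. The Green's function of $-\frac{d^2}{ds^2}$ with Dirichlet boundary condition on $[\bar a,\bar b]$ is $$G(s,t)=\frac{1}{\bar b-\bar a}\begin{cases}(s-\bar a)(\bar b-t), & \bar a\le s\le t\le\bar b,\\ (\bar b-s)(t-\bar a), & \bar a\le t\le s\le\bar b.\end{cases}$$ Convergence in $C^1_{loc}(\mathbb{R})$ means: for every compact $K\subset\mathbb{R}$, $K\subset\tilde I_\lambda$ for all sufficiently small $\lambda>0$, and $\tilde U_\lambda\to U$, $\tilde U_\lambda'\to U'$ uniformly on $K$. *)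

theory Defs
  imports "HOL-Analysis.Analysis" "HOL-Probability.Essential_Supremum"
begin

definition annulus :: "real \<Rightarrow> real \<Rightarrow> 'a::euclidean_space set" where
  "annulus a b = {x. a < norm x \<and> norm x < b}"

definition partial_at :: "'a::euclidean_space \<Rightarrow> ('a \<Rightarrow> real) \<Rightarrow> 'a \<Rightarrow> real" where
  "partial_at i u x = frechet_derivative u (at x) i"

text \<open>The following is meant for open \<open>S\<close>: all derivatives are taken with respect to
  the full neighbourhood filter of a point.\<close>

definition C2_on :: "'a::euclidean_space set \<Rightarrow> ('a \<Rightarrow> real) \<Rightarrow> bool" where
  "C2_on S u \<longleftrightarrow>
     (\<forall>x\<in>S. u differentiable (at x)) \<and>
     (\<forall>i\<in>Basis. \<forall>x\<in>S. partial_at i u differentiable (at x)) \<and>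
     (\<forall>i\<in>Basis. \<forall>j\<in>Basis. continuous_on S (partial_at j (partial_at i u)))"

definition laplacian :: "('a::euclidean_space \<Rightarrow> real) \<Rightarrow> 'a \<Rightarrow> real" where
  "laplacian u x = (\<Sum>i\<in>Basis. partial_at i (partial_at i u) x)"

text \<open>A function on the closed annulus is represented by a total function whose values
  outside are irrelevant, so solutions have to be compared on the closed annulus only.\<close>

definition solution ::
  "real \<Rightarrow> real \<Rightarrow> real \<Rightarrow> ('a::euclidean_space \<Rightarrow> real) \<Rightarrow> bool" where
  "solution a b lam u \<longleftrightarrow>
     C2_on (annulus a b) u \<and> continuous_on (closure (annulus a b)) u \<and>
     (\<forall>x\<in>annulus a b. - laplacian u x =
        lam * (real DIM('a) - 2)\<^sup>2 * exp (u x) / norm x ^ (2 * (DIM('a) - 1))) \<and>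
     (\<forall>x\<in>frontier (annulus a b). u x = 0)"

definition radial_on :: "'a::real_normed_vector set \<Rightarrow> ('a \<Rightarrow> real) \<Rightarrow> bool" where
  "radial_on S u \<longleftrightarrow> (\<forall>x\<in>S. \<forall>y\<in>S. norm x = norm y \<longrightarrow> u x = u y)"

definition radial_solution ::
  "real \<Rightarrow> real \<Rightarrow> real \<Rightarrow> ('a::euclidean_space \<Rightarrow> real) \<Rightarrow> bool" where
  "radial_solution a b lam u \<longleftrightarrow> solution a b lam u \<and> radial_on (closure (annulus a b)) u"

definition eq_on :: "'a set \<Rightarrow> ('a \<Rightarrow> real) \<Rightarrow> ('a \<Rightarrow> real) \<Rightarrow> bool" where
  "eq_on S u v \<longleftrightarrow> (\<forall>x\<in>S. u x = v x)"

text \<open>The common value of \<open>u\<close> on the sphere of radius \<open>r\<close>, i.e. a radial function viewed as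
  a function of \<open>r\<close>; unspecified if \<open>u\<close> is not constant on that sphere.\<close>

definition radial_profile :: "('a::real_normed_vector \<Rightarrow> real) \<Rightarrow> real \<Rightarrow> real" where
  "radial_profile u r = the_elem (u ` sphere 0 r)"

definition Linf_norm :: "'a::euclidean_space set \<Rightarrow> ('a \<Rightarrow> real) \<Rightarrow> real" where
  "Linf_norm S u = real_of_ereal (esssup (lebesgue_on S) (\<lambda>x. ereal \<bar>u x\<bar>))"

definition green :: "real \<Rightarrow> real \<Rightarrow> real \<Rightarrow> real \<Rightarrow> real" where
  "green p q s t = (if s \<le> t then (s - p) * (q - t) else (q - s) * (t - p)) / (q - p)"

definition rescaled_domain :: "real \<Rightarrow> real \<Rightarrow> nat \<Rightarrow> real \<Rightarrow> real set" where
  "rescaled_domain a b N d =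
     {- (a powr (2 - real N) - b powr (2 - real N)) / (2 * d) <..<
        (a powr (2 - real N) - b powr (2 - real N)) / (2 * d)}"

definition rescaled ::
  "real \<Rightarrow> real \<Rightarrow> real \<Rightarrow> ('a::euclidean_space \<Rightarrow> real) \<Rightarrow> real \<Rightarrow> real" where
  "rescaled a b d u t =
     radial_profile u
       ((d * t + (a powr (2 - real DIM('a)) + b powr (2 - real DIM('a))) / 2)
          powr (1 / (2 - real DIM('a))))
     - Linf_norm (annulus a b :: 'a set) u"

text \<open>\<open>C\<^sup>1\<close> convergence on compact sets, along \<open>F\<close>, of functions \<open>f l\<close> that live on varying
  open domains \<open>I l\<close>. The \<open>C\<^sup>1\<close> clauses make \<open>deriv\<close> meaningful.\<close>

definition C1_loc_limit ::
  "('b \<Rightarrow> real set) \<Rightarrow> ('b \<Rightarrow> real \<Rightarrow> real) \<Rightarrow> (real \<Rightarrow> real) \<Rightarrow> 'b filter \<Rightarrow> bool" where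
  "C1_loc_limit I f g F \<longleftrightarrow>
     (\<forall>\<^sub>F l in F. f l C1_differentiable_on I l) \<and> g C1_differentiable_on UNIV \<and>
     (\<forall>K. compact K \<longrightarrow>
        (\<forall>\<^sub>F l in F. K \<subseteq> I l) \<and>
        uniform_limit K f g F \<and>
        uniform_limit K (\<lambda>l. deriv (f l)) (deriv g) F)"

end

theory Submission
  imports Defs "HOL-Real_Asymp.Real_Asymp"
begin

text \<open>
  The function \<open>|x| powr (2 - N)\<close> is harmonic, so a radial function \<open>u x = W \<tau>\<close> written in an
  affine function \<open>\<tau>\<close> of it satisfies \<open>laplacian u = W'' * |\<nabla>\<tau>|\<^sup>2\<close> without any first-order term.
  The weight \<open>(N - 2)\<^sup>2 / |x| ^ (2 * (N - 1))\<close> is, up to a constant, exactly \<open>|\<nabla>\<tau>|\<^sup>2\<close>. If \<open>\<tau>\<close>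
  is normalised to run over \<open>[-1, 1]\<close> on the annulus and \<open>L\<close> denotes half the length of the
  interval of values of \<open>|x| powr (2 - N)\<close>, the radial problem becomes the Liouville equation
  \<open>W'' = - lam * L\<^sup>2 * exp W\<close> with \<open>W (-1) = W 1 = 0\<close> (locale \<open>annular_shell\<close>).

  This equation can be solved explicitly. The energy \<open>W'\<^sup>2 / 2 + lam * L\<^sup>2 * exp W\<close> is conserved,
  and this makes \<open>y = exp (- W / 2)\<close> a solution of the linear equation \<open>y'' = \<theta>\<^sup>2 * y\<close>; the boundary
  values force \<open>y \<tau> = cosh (\<theta> * \<tau>) / cosh \<theta>\<close>. Hence the radial solutions are the functions
  \<open>2 * ln (cosh \<theta> / cosh (\<theta> * \<tau>))\<close> with \<open>\<theta> > 0\<close> and \<open>lam * L\<^sup>2 = 2 * (\<theta> / cosh \<theta>)\<^sup>2\<close>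
  (\<open>liouville_dirichlet_unique\<close>, \<open>radial_solution_radial_bubble\<close>,
  \<open>radial_solution_imp_radial_bubble\<close>). The map \<open>\<theta> \<mapsto> \<theta> / cosh \<theta>\<close> increases from \<open>0\<close> to a maximum
  and then decreases back to \<open>0\<close> (\<open>load_unimodal\<close>), which gives the count of solutions: none above
  the value \<open>lam_star\<close> belonging to the maximum, one at it, and below it two, with parameters
  \<open>\<theta>1 < \<theta>2\<close>. As \<open>lam\<close> tends to \<open>0\<close>, \<open>\<theta>1\<close> tends to \<open>0\<close> and \<open>\<theta>2\<close> to infinity (\<open>load_branches\<close>).

  Every limit is then read off from the formula. The maximum of a solution is \<open>2 * ln (cosh \<theta>)\<close>,
  attained at \<open>\<tau> = 0\<close>, so the minimal solution tends to \<open>0\<close> uniformly and its mass vanishes, while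
  the normalisation of \<open>\<delta>\<close> says \<open>\<delta> = L / (sqrt 2 * \<theta>2)\<close>. With this \<open>\<delta>\<close> the rescaled large solution
  is \<open>- 2 * ln (cosh (t / sqrt 2))\<close>, which is the limit profile itself, on its whole domain; only the
  domain depends on \<open>lam\<close>. Since \<open>ln (cosh s)\<close> differs from \<open>|s|\<close> by at most \<open>ln 2\<close>, the
  large solution is within \<open>2 * ln 2\<close> of the tent \<open>2 * \<theta>2 * (1 - |\<tau>|)\<close>, and \<open>\<delta>\<close> times this tent
  is the stated multiple of the Green's function at the midpoint. Finally the large solution
  contributes a mass at least proportional to \<open>\<theta>2\<close> in a shell of width \<open>1 / \<theta>2\<close> (\<open>mass_ge\<close>).
\<close>

section \<open>Radial functions on an annulus\<close>

lemma open_annulus: "open (annulus a b)"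
  unfolding annulus_def by (intro open_Collect_conj open_Collect_less continuous_intros)

lemma closure_annulus:
  fixes a b :: real
  assumes "0 < a" "a < b"
  shows "closure (annulus a b :: 'a::euclidean_space set) = {x. a \<le> norm x \<and> norm x \<le> b}"
proof (rule antisym)
  have "closed {x::'a. a \<le> norm x \<and> norm x \<le> b}"
    by (intro closed_Collect_conj closed_Collect_le continuous_intros)
  then show "closure (annulus a b :: 'a set) \<subseteq> {x. a \<le> norm x \<and> norm x \<le> b}"
    by (intro closure_minimal) (auto simp: annulus_def)
next
  show "{x. a \<le> norm x \<and> norm x \<le> b} \<subseteq> closure (annulus a b :: 'a set)"
  proof
    fix x :: 'a assume "x \<in> {x. a \<le> norm x \<and> norm x \<le> b}"
    then have x: "norm x \<in> {a..b}" by simp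
    have "(\<lambda>t. t *\<^sub>R sgn x) ` closure {a<..<b} \<subseteq> closure ((\<lambda>t. t *\<^sub>R sgn x) ` {a<..<b})"
      by (intro continuous_image_closure_subset[of UNIV] continuous_intros) auto
    moreover have "(\<lambda>t. t *\<^sub>R sgn x) ` {a<..<b} \<subseteq> annulus a b"
      using x assms by (auto simp: annulus_def norm_sgn)
    ultimately have "(\<lambda>t. t *\<^sub>R sgn x) ` {a..b} \<subseteq> closure (annulus a b)"
      using closure_mono[of "(\<lambda>t. t *\<^sub>R sgn x) ` {a<..<b}" "annulus a b"] assms(2) by simp
    moreover have "x = norm x *\<^sub>R sgn x" by (cases "x = 0") (auto simp: sgn_div_norm)
    ultimately show "x \<in> closure (annulus a b)" using x by auto
  qed
qed

lemma frontier_annulus: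
  fixes a b :: real
  assumes "0 < a" "a < b"
  shows "frontier (annulus a b :: 'a::euclidean_space set) = {x. norm x = a \<or> norm x = b}"
  using assms unfolding frontier_def closure_annulus[OF assms] interior_open[OF open_annulus]
  by (auto simp: annulus_def)

lemma partial_at_eqI:
  assumes "(u has_derivative D) (at x)"
  shows "partial_at i u x = D i"
  using frechet_derivative_at[OF assms] by (simp add: partial_at_def)

text \<open>Having a given derivative is a local property, and \<^const>\<open>frechet_derivative\<close> chooses among
  the same candidates for both functions, even where there are none.\<close>
lemma partial_at_cong_open:
  assumes "open S" "x \<in> S" "\<And>y. y \<in> S \<Longrightarrow> u y = v y"
  shows "partial_at i u x = partial_at i v x"
proof -
  have "(u has_derivative D) (at x) \<longleftrightarrow> (v has_derivative D) (at x)" for D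
    using assms has_derivative_transform_within_open[of _ D x UNIV S] by metis
  then show ?thesis by (simp add: partial_at_def frechet_derivative_def)
qed

lemma laplacian_cong_open:
  assumes "open S" "x \<in> S" "\<And>y. y \<in> S \<Longrightarrow> u y = v y"
  shows "laplacian u x = laplacian v x"
  unfolding laplacian_def
  by (intro sum.cong refl partial_at_cong_open[OF assms(1,2)])
     (rule partial_at_cong_open[OF assms(1) _ assms(3)])

lemma has_derivative_comp_norm:
  fixes x :: "'a::euclidean_space"
  assumes "x \<noteq> 0" "(f has_real_derivative d) (at (norm x))"
  shows "((\<lambda>x. f (norm x)) has_derivative (\<lambda>h. d * ((x \<bullet> h) / norm x))) (at x)"
proof -
  have "((\<lambda>x. f (norm x)) has_derivative (\<lambda>h. d * (sgn x \<bullet> h))) (at x)"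
    using has_derivative_compose[OF has_derivative_norm[OF assms(1)]
        assms(2)[unfolded has_field_derivative_def]] by (simp add: inner_commute)
  then show ?thesis by (simp add: sgn_div_norm inner_commute divide_inverse mult_ac)
qed

text \<open>The gradient of \<open>f (norm x)\<close> is \<open>k (norm x) *\<^sub>R x\<close> with \<open>k r = f' r / r\<close>, and its divergence is
  \<open>N * k r + r * k' r = f'' r + (N - 1) / r * f' r\<close>.\<close>
lemma C2_on_comp_norm:
  fixes f f1 f2 :: "real \<Rightarrow> real"
  assumes "0 \<le> a"
    and f: "\<And>r. r \<in> {a<..<b} \<Longrightarrow> (f has_real_derivative f1 r) (at r)"
    and f1: "\<And>r. r \<in> {a<..<b} \<Longrightarrow> (f1 has_real_derivative f2 r) (at r)"
    and f2: "continuous_on {a<..<b} f2"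
  shows "C2_on (annulus a b) (\<lambda>x::'a::euclidean_space. f (norm x))" (is ?C2)
    and "x \<in> annulus a b \<Longrightarrow> laplacian (\<lambda>x::'a. f (norm x)) x
           = f2 (norm x) + (real DIM('a) - 1) / norm x * f1 (norm x)"
proof -
  let ?A = "annulus a b :: 'a set"
  define u where "u = (\<lambda>x::'a. f (norm x))"
  define k where "k r = f1 r / r" for r
  define k1 where "k1 r = (f2 r - f1 r / r) / r" for r
  have norm_A: "norm x \<in> {a<..<b}" "x \<noteq> 0" "norm x > 0" if "x \<in> ?A" for x
    using that assms(1) by (auto simp: annulus_def)
  have k: "(k has_real_derivative k1 r) (at r)" if "r \<in> {a<..<b}" for r
    unfolding k_def k1_def using that assms(1) f1[OF that]
    by (auto intro!: derivative_eq_intros simp: field_simps)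
  have du: "(u has_derivative (\<lambda>h. f1 (norm x) * ((x \<bullet> h) / norm x))) (at x)" if "x \<in> ?A" for x
    unfolding u_def by (rule has_derivative_comp_norm[OF norm_A(2)[OF that] f[OF norm_A(1)[OF that]]])
  have pu: "partial_at i u x = k (norm x) * (x \<bullet> i)" if "x \<in> ?A" for i x
    using partial_at_eqI[OF du[OF that]] by (simp add: k_def)
  have dpu: "(partial_at i u has_derivative
      (\<lambda>h. k (norm x) * (h \<bullet> i) + k1 (norm x) * ((x \<bullet> h) / norm x) * (x \<bullet> i))) (at x)"
    if "x \<in> ?A" for i x
  proof -
    have "((\<lambda>x. k (norm x) * (x \<bullet> i)) has_derivative
      (\<lambda>h. k (norm x) * (h \<bullet> i) + k1 (norm x) * ((x \<bullet> h) / norm x) * (x \<bullet> i))) (at x)"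
      by (rule has_derivative_mult[OF
            has_derivative_comp_norm[OF norm_A(2)[OF that] k[OF norm_A(1)[OF that]]]])
         (intro derivative_intros)
    then show ?thesis
      by (rule has_derivative_transform_within_open[OF _ open_annulus that]) (simp add: pu)
  qed
  have ppu: "partial_at j (partial_at i u) x
      = k (norm x) * (j \<bullet> i) + k1 (norm x) * ((x \<bullet> j) / norm x) * (x \<bullet> i)"
    if "x \<in> ?A" for i j x
    by (rule partial_at_eqI[OF dpu[OF that]])
  have cf1: "continuous_on {a<..<b} f1"
    by (intro continuous_at_imp_continuous_on ballI DERIV_isCont[OF f1])
  have ck: "continuous_on ?A (\<lambda>x. k (norm x))" and ck1: "continuous_on ?A (\<lambda>x. k1 (norm x))"
    unfolding k_def k1_def using norm_A
    by (auto intro!: continuous_intros continuous_on_compose2[OF cf1] continuous_on_compose2[OF f2])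
  show ?C2
    unfolding C2_on_def u_def[symmetric]
  proof (intro conjI ballI)
    show "u differentiable (at x)" if "x \<in> ?A" for x
      using du[OF that] by (auto simp: differentiable_def)
    show "partial_at i u differentiable (at x)" if "x \<in> ?A" for i x
      using dpu[OF that] by (auto simp: differentiable_def)
    have "continuous_on ?A (\<lambda>x. k (norm x) * (j \<bullet> i) + k1 (norm x) * ((x \<bullet> j) / norm x) * (x \<bullet> i))"
      for i j
      using norm_A by (intro continuous_intros ck ck1) auto
    then show "continuous_on ?A (partial_at j (partial_at i u))" for i j
      by (subst continuous_on_cong[OF refl ppu]) auto
  qed
  show "laplacian (\<lambda>x::'a. f (norm x)) x
           = f2 (norm x) + (real DIM('a) - 1) / norm x * f1 (norm x)" if x: "x \<in> ?A" for x
  proof -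
    have "laplacian u x
        = (\<Sum>i\<in>Basis. k (norm x) + k1 (norm x) / norm x * ((x \<bullet> i) * (x \<bullet> i)))"
      unfolding laplacian_def by (intro sum.cong) (auto simp: ppu[OF x])
    also have "\<dots> = real DIM('a) * k (norm x) + k1 (norm x) / norm x * (\<Sum>i\<in>Basis. (x \<bullet> i) * (x \<bullet> i))"
      by (simp add: sum.distrib sum_distrib_left)
    also have "(\<Sum>i\<in>Basis. (x \<bullet> i) * (x \<bullet> i)) = norm x * norm x"
      by (metis euclidean_inner power2_eq_square power2_norm_eq_inner)
    also have "k1 (norm x) / norm x * (norm x * norm x) = f2 (norm x) - f1 (norm x) / norm x"
      using norm_A(3)[OF x] by (simp add: k1_def)
    finally show ?thesis
      by (simp add: u_def k_def left_diff_distrib diff_divide_distrib)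
  qed
qed

text \<open>The profile \<open>f r = u (r *\<^sub>R i)\<close> is a restriction of \<open>u\<close> to a ray, so its two derivatives are the
  first and second partial derivatives of \<open>u\<close> in the direction \<open>i\<close>. Since \<open>u\<close> coincides with
  \<open>f (norm x)\<close> on the open annulus, the preceding formula computes its Laplacian.\<close>
lemma C2_on_radial_imp_profile:
  fixes u :: "'a::euclidean_space \<Rightarrow> real"
  assumes "0 \<le> a" and C2: "C2_on (annulus a b) u" and rad: "radial_on (annulus a b) u"
    and i: "i \<in> Basis"
  obtains f1 f2 where
    "\<And>r. r \<in> {a<..<b} \<Longrightarrow> ((\<lambda>r. u (r *\<^sub>R i)) has_real_derivative f1 r) (at r)"
    "\<And>r. r \<in> {a<..<b} \<Longrightarrow> (f1 has_real_derivative f2 r) (at r)"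
    "\<And>r. r \<in> {a<..<b} \<Longrightarrow> laplacian u (r *\<^sub>R i) = f2 r + (real DIM('a) - 1) / r * f1 r"
proof -
  let ?A = "annulus a b :: 'a set"
  have mem: "r *\<^sub>R i \<in> ?A" if "r \<in> {a<..<b}" for r
    using that i assms(1) by (auto simp: annulus_def)
  have chain: "((\<lambda>r. v (r *\<^sub>R i)) has_real_derivative partial_at i v (r *\<^sub>R i)) (at r)"
    if "r \<in> {a<..<b}" "v differentiable (at (r *\<^sub>R i))" for v :: "'a \<Rightarrow> real" and r
  proof -
    let ?D = "frechet_derivative v (at (r *\<^sub>R i))"
    have D: "(v has_derivative ?D) (at (r *\<^sub>R i))"
      using that(2) frechet_derivative_works by blast
    have "((\<lambda>r. v (r *\<^sub>R i)) has_derivative (\<lambda>h. ?D (h *\<^sub>R i))) (at r)"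
      by (rule has_derivative_compose[where g = v and f = "\<lambda>r. r *\<^sub>R i" and x = r, OF _ D]) (auto intro!: derivative_eq_intros)
    moreover have "?D (h *\<^sub>R i) = ?D i * h" for h
      using linear_cmul[OF has_derivative_linear[OF D]] by (simp add: mult.commute)
    ultimately show ?thesis
      by (simp add: has_field_derivative_def partial_at_def)
  qed
  define f where "f r = u (r *\<^sub>R i)" for r
  define f1 where "f1 r = partial_at i u (r *\<^sub>R i)" for r
  define f2 where "f2 r = partial_at i (partial_at i u) (r *\<^sub>R i)" for r
  have 1: "(f has_real_derivative f1 r) (at r)" if "r \<in> {a<..<b}" for r
    unfolding f_def f1_def using C2 mem[OF that] by (intro chain that) (auto simp: C2_on_def)
  have 2: "(f1 has_real_derivative f2 r) (at r)" if "r \<in> {a<..<b}" for r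
    unfolding f1_def f2_def using C2 mem[OF that] i by (intro chain that) (auto simp: C2_on_def)
  have "continuous_on ?A (partial_at i (partial_at i u))"
    using C2 i by (auto simp: C2_on_def)
  then have c: "continuous_on {a<..<b} f2"
    unfolding f2_def by (rule continuous_on_compose2) (auto intro!: continuous_intros mem)
  have 3: "laplacian u (r *\<^sub>R i) = f2 r + (real DIM('a) - 1) / r * f1 r" if r: "r \<in> {a<..<b}" for r
  proof -
    have "u y = f (norm y)" if "y \<in> ?A" for y
    proof -
      have "norm y *\<^sub>R i \<in> ?A" "norm y = norm (norm y *\<^sub>R i)"
        using that i mem[of "norm y"] by (simp_all add: annulus_def)
      then show ?thesis
        using rad that unfolding radial_on_def f_def by blast
    qed
    then have "laplacian u (r *\<^sub>R i) = laplacian (\<lambda>x. f (norm x)) (r *\<^sub>R i)"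
      by (rule laplacian_cong_open[OF open_annulus mem[OF r]])
    also have "\<dots> = f2 r + (real DIM('a) - 1) / r * f1 r"
      using C2_on_comp_norm(2)[OF assms(1) 1 2 c mem[OF r]] i r assms(1) by auto
    finally show ?thesis .
  qed
  show thesis
    using that[OF 1[unfolded f_def] 2 3] .
qed

section \<open>The one-dimensional Liouville equation\<close>

text \<open>The solution of \<open>W'' = - \<nu> * exp W\<close> on \<open>[-1, 1]\<close> with zero boundary values and
  \<open>\<nu> = 2 * (\<theta> / cosh \<theta>)\<^sup>2\<close>; \<open>\<theta>\<close> parametrises the whole solution curve and measures the height.\<close>
definition bubble :: "real \<Rightarrow> real \<Rightarrow> real" where
  "bubble \<theta> \<tau> = 2 * ln (cosh \<theta> / cosh (\<theta> * \<tau>))"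

text \<open>The square root of \<open>\<nu> / 2\<close> on the solution curve, as a function of the curve parameter.\<close>
definition load :: "real \<Rightarrow> real" where
  "load \<theta> = \<theta> / cosh \<theta>"

lemma bubble_ends: "bubble \<theta> 1 = 0" "bubble \<theta> (- 1) = 0"
  by (simp_all add: bubble_def)

lemma bubble_0: "bubble \<theta> 0 = 2 * ln (cosh \<theta>)"
  by (simp add: bubble_def)

lemma exp_bubble: "exp (bubble \<theta> \<tau>) = (cosh \<theta> / cosh (\<theta> * \<tau>))\<^sup>2"
proof -
  have "exp (2 * ln (cosh \<theta> / cosh (\<theta> * \<tau>))) = exp (ln (cosh \<theta> / cosh (\<theta> * \<tau>))) ^ 2"
    by (simp add: exp_double)
  then show ?thesis by (simp add: bubble_def)
qed

lemma bubble_deriv: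
  "(bubble \<theta> has_real_derivative - 2 * \<theta> * sinh (\<theta> * \<tau>) / cosh (\<theta> * \<tau>)) (at \<tau>)"
  unfolding bubble_def
  by (auto intro!: derivative_eq_intros simp: field_simps)

lemma bubble_deriv2:
  "((\<lambda>\<tau>. - 2 * \<theta> * sinh (\<theta> * \<tau>) / cosh (\<theta> * \<tau>)) has_real_derivative
      - (2 * (load \<theta>)\<^sup>2 * exp (bubble \<theta> \<tau>))) (at \<tau>)"
proof -
  let ?c = "cosh (\<theta> * \<tau>)" and ?s = "sinh (\<theta> * \<tau>)"
  have "((\<lambda>\<tau>. - 2 * \<theta> * (sinh (\<theta> * \<tau>) / cosh (\<theta> * \<tau>))) has_real_derivative
      - 2 * \<theta> * ((?c * \<theta> * ?c - ?s * (?s * \<theta>)) / (?c * ?c))) (at \<tau>)"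
    by (rule derivative_eq_intros | simp)+
  moreover have "- 2 * \<theta> * ((?c * \<theta> * ?c - ?s * (?s * \<theta>)) / (?c * ?c))
     = - (2 * \<theta>\<^sup>2 * (?c\<^sup>2 - ?s\<^sup>2) / ?c\<^sup>2)"
  proof -
    have "?c * \<theta> * ?c - ?s * (?s * \<theta>) = \<theta> * (?c\<^sup>2 - ?s\<^sup>2)"
      by (simp add: algebra_simps power2_eq_square)
    then show ?thesis by (simp add: power2_eq_square)
  qed
  moreover have "\<dots> = - (2 * (load \<theta>)\<^sup>2 * exp (bubble \<theta> \<tau>))"
    by (simp add: hyperbolic_pythagoras exp_bubble load_def power_divide)
  ultimately show ?thesis by simp
qed

lemma cosh_mult_le:
  fixes \<theta> \<tau> :: real
  assumes "\<bar>\<tau>\<bar> \<le> 1"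
  shows "cosh (\<theta> * \<tau>) \<le> cosh \<theta>"
proof -
  have "\<bar>\<theta> * \<tau>\<bar> \<le> \<bar>\<theta>\<bar>" using assms by (simp add: abs_mult mult_left_le)
  then show ?thesis
    using cosh_real_nonneg_le_iff[of "\<bar>\<theta> * \<tau>\<bar>" "\<bar>\<theta>\<bar>"] by simp
qed

lemma bubble_nonneg:
  assumes "\<bar>\<tau>\<bar> \<le> 1"
  shows "0 \<le> bubble \<theta> \<tau>"
  using cosh_mult_le[OF assms, of \<theta>] by (simp add: bubble_def)

lemma bubble_le_max: "bubble \<theta> \<tau> \<le> bubble \<theta> 0"
proof -
  have "cosh \<theta> / cosh (\<theta> * \<tau>) \<le> cosh \<theta> / 1"
    by (intro divide_left_mono cosh_real_ge_1) auto
  then have "ln (cosh \<theta> / cosh (\<theta> * \<tau>)) \<le> ln (cosh \<theta>)"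
    by simp
  then show ?thesis by (simp add: bubble_def)
qed

text \<open>The claim is \<open>cosh \<theta> * cosh (\<eta> * \<tau>) \<le> cosh \<eta> * cosh (\<theta> * \<tau>)\<close>. Writing both products as sums
  of hyperbolic cosines, each summand on the left is dominated by one on the right.\<close>
lemma bubble_mono:
  assumes "0 \<le> \<theta>" "\<theta> \<le> \<eta>" "\<bar>\<tau>\<bar> \<le> 1"
  shows "bubble \<theta> \<tau> \<le> bubble \<eta> \<tau>"
proof -
  define \<sigma> where "\<sigma> = \<bar>\<tau>\<bar>"
  have \<sigma>: "0 \<le> \<sigma>" "\<sigma> \<le> 1" using assms(3) by (auto simp: \<sigma>_def)
  have even: "cosh (\<xi> * \<tau>) = cosh (\<xi> * \<sigma>)" for \<xi> :: real
    by (cases "\<tau> \<ge> 0") (auto simp: \<sigma>_def)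
  have prod: "2 * (cosh x * cosh y) = cosh (x + y) + cosh (x - y)" for x y :: real
    by (simp add: cosh_add cosh_diff)
  have le: "cosh x \<le> cosh y" if "\<bar>x\<bar> \<le> y" for x y :: real
    using cosh_real_nonneg_le_iff[of "\<bar>x\<bar>" y] that by simp
  have p: "0 \<le> (1 - \<sigma>) * (\<eta> - \<theta>)" "0 \<le> (1 + \<sigma>) * (\<eta> - \<theta>)" "0 \<le> (1 - \<sigma>) * (\<eta> + \<theta>)" "0 \<le> \<sigma> * \<eta>"
    using assms \<sigma> by auto
  have "cosh (\<theta> + \<eta> * \<sigma>) \<le> cosh (\<eta> + \<theta> * \<sigma>)" "cosh (\<theta> - \<eta> * \<sigma>) \<le> cosh (\<eta> - \<theta> * \<sigma>)"
    using p assms by (auto intro!: le simp: algebra_simps abs_le_iff)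
  then have "cosh \<theta> * cosh (\<eta> * \<sigma>) \<le> cosh \<eta> * cosh (\<theta> * \<sigma>)"
    using prod[of \<theta> "\<eta> * \<sigma>"] prod[of \<eta> "\<theta> * \<sigma>"] by linarith
  then have "cosh \<theta> / cosh (\<theta> * \<sigma>) \<le> cosh \<eta> / cosh (\<eta> * \<sigma>)"
    by (simp add: field_simps)
  then show ?thesis by (simp add: bubble_def even)
qed

lemma abs_minus_ln_cosh: "0 \<le> \<bar>x\<bar> - ln (cosh x)" "\<bar>x\<bar> - ln (cosh x) \<le> ln 2" for x :: real
proof -
  have "cosh \<bar>x\<bar> \<le> exp \<bar>x\<bar>"  "exp \<bar>x\<bar> \<le> 2 * cosh \<bar>x\<bar>"
    by (simp_all add: cosh_field_def)
  then have "cosh x \<le> exp \<bar>x\<bar>" "exp \<bar>x\<bar> \<le> 2 * cosh x" by simp_all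
  then have "ln (cosh x) \<le> ln (exp \<bar>x\<bar>)" "ln (exp \<bar>x\<bar>) \<le> ln (2 * cosh x)"
    by (subst ln_le_cancel_iff; simp)+
  then show "0 \<le> \<bar>x\<bar> - ln (cosh x)" "\<bar>x\<bar> - ln (cosh x) \<le> ln 2"
    by (simp_all add: ln_mult)
qed

text \<open>Away from its peak a tall solution is a pair of straight lines: \<open>ln cosh\<close> is replaced by the
  absolute value at a cost that does not depend on the height.\<close>
lemma bubble_tent:
  "\<bar>bubble \<theta> \<tau> - 2 * \<bar>\<theta>\<bar> * (1 - \<bar>\<tau>\<bar>)\<bar> \<le> 2 * ln 2"
proof -
  have eq: "bubble \<theta> \<tau> - 2 * \<bar>\<theta>\<bar> * (1 - \<bar>\<tau>\<bar>)
      = 2 * (\<bar>\<theta> * \<tau>\<bar> - ln (cosh (\<theta> * \<tau>))) - 2 * (\<bar>\<theta>\<bar> - ln (cosh \<theta>))"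
    by (simp add: bubble_def ln_div abs_mult algebra_simps)
  have "\<bar>2 * p - 2 * q\<bar> \<le> 2 * c" if "0 \<le> p" "p \<le> c" "0 \<le> q" "q \<le> c" for p q c :: real
    using that by linarith
  then show ?thesis
    unfolding eq using abs_minus_ln_cosh by blast
qed

text \<open>Conservation of energy linearises the equation: for \<open>y = exp (- W / 2)\<close> one has
  \<open>y'' = (W'\<^sup>2 / 4 - W'' / 2) * y\<close>, and the factor is half the energy. Solving the linear equation on
  the open interval and passing to the end points by continuity determines \<open>W\<close>; the two boundary
  conditions force the coefficients of \<open>exp (\<theta> * \<tau>)\<close> and \<open>exp (- (\<theta> * \<tau>))\<close> in \<open>y\<close> to be equal.\<close>
lemma liouville_dirichlet_unique:
  fixes W W1 :: "real \<Rightarrow> real" and \<nu> :: real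
  assumes "\<nu> > 0" and cont: "continuous_on {-1..1} W" and ends: "W (-1) = 0" "W 1 = 0"
    and W: "\<And>\<tau>. \<tau> \<in> {-1<..<1} \<Longrightarrow> (W has_real_derivative W1 \<tau>) (at \<tau>)"
    and W1: "\<And>\<tau>. \<tau> \<in> {-1<..<1} \<Longrightarrow> (W1 has_real_derivative - (\<nu> * exp (W \<tau>))) (at \<tau>)"
  obtains \<theta> where "\<theta> > 0" "\<nu> = 2 * (load \<theta>)\<^sup>2" "\<And>\<tau>. \<tau> \<in> {-1..1} \<Longrightarrow> W \<tau> = bubble \<theta> \<tau>"
proof -
  define E where "E \<tau> = (W1 \<tau>)\<^sup>2 / 2 + \<nu> * exp (W \<tau>)" for \<tau>
  have "(E has_real_derivative 0) (at \<tau>)" if "\<tau> \<in> {-1<..<1}" for \<tau>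
    unfolding E_def using W[OF that] W1[OF that]
    by (auto intro!: derivative_eq_intros)
  then have E: "E \<tau> = E 0" if "\<tau> \<in> {-1<..<1}" for \<tau>
    using DERIV_isconst3[of "-1" 1 \<tau> 0 E] that by auto
  have "E 0 > 0" using assms(1) by (auto simp: E_def intro!: add_nonneg_pos)
  define \<theta> where "\<theta> = sqrt (E 0 / 2)"
  have \<theta>: "\<theta> > 0" "E 0 = 2 * \<theta>\<^sup>2" using \<open>E 0 > 0\<close> by (auto simp: \<theta>_def)
  define y where "y \<tau> = exp (- W \<tau> / 2)" for \<tau>
  define y1 where "y1 \<tau> = - W1 \<tau> / 2 * y \<tau>" for \<tau>
  have y: "(y has_real_derivative y1 \<tau>) (at \<tau>)" if "\<tau> \<in> {-1<..<1}" for \<tau>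
    unfolding y_def y1_def using W[OF that] by (auto intro!: derivative_eq_intros)
  have y1: "(y1 has_real_derivative \<theta>\<^sup>2 * y \<tau>) (at \<tau>)" if "\<tau> \<in> {-1<..<1}" for \<tau>
  proof -
    have "(y1 has_real_derivative E \<tau> / 2 * y \<tau>) (at \<tau>)"
      unfolding y1_def E_def using W1[OF that] y[OF that]
      by (auto intro!: derivative_eq_intros simp: y1_def power2_eq_square field_simps)
    then show ?thesis using E[OF that] \<theta>(2) by simp
  qed
    \<comment> \<open>The equation \<open>y'' = \<theta>\<^sup>2 * y\<close> factors into two first-order equations, for \<open>y' - \<theta> * y\<close> and
    \<open>y' + \<theta> * y\<close>; \<open>P\<close> and \<open>Q\<close> are their first integrals.\<close>
define P where "P \<tau> = (y1 \<tau> - \<theta> * y \<tau>) * exp (\<theta> * \<tau>)" for \<tau>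
  define Q where "Q \<tau> = (y1 \<tau> + \<theta> * y \<tau>) * exp (- (\<theta> * \<tau>))" for \<tau>
  have "(P has_real_derivative 0) (at \<tau>)" "(Q has_real_derivative 0) (at \<tau>)"
    if "\<tau> \<in> {-1<..<1}" for \<tau>
    unfolding P_def Q_def using y[OF that] y1[OF that]
    by (auto intro!: derivative_eq_intros simp: power2_eq_square algebra_simps)
  then have PQ: "P \<tau> = P 0" "Q \<tau> = Q 0" if "\<tau> \<in> {-1<..<1}" for \<tau>
    using DERIV_isconst3[of "-1" 1 \<tau> 0 P] DERIV_isconst3[of "-1" 1 \<tau> 0 Q] that by auto
  define h where "h \<tau> = Q 0 * exp (\<theta> * \<tau>) - P 0 * exp (- (\<theta> * \<tau>)) - 2 * \<theta> * y \<tau>" for \<tau>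
  have "h \<tau> = 0" if "\<tau> \<in> {-1<..<1}" for \<tau>
  proof -
    have "h \<tau> = Q \<tau> * exp (\<theta> * \<tau>) - P \<tau> * exp (- (\<theta> * \<tau>)) - 2 * \<theta> * y \<tau>"
      using PQ[OF that] by (simp add: h_def)
    also have "\<dots> = (y1 \<tau> + \<theta> * y \<tau>) * (exp (- (\<theta> * \<tau>)) * exp (\<theta> * \<tau>))
        - (y1 \<tau> - \<theta> * y \<tau>) * (exp (\<theta> * \<tau>) * exp (- (\<theta> * \<tau>))) - 2 * \<theta> * y \<tau>"
      by (simp add: P_def Q_def)
    also have "\<dots> = 0" by (simp add: exp_minus)
    finally show ?thesis .
  qed
  moreover have "continuous_on {-1..1} h"
    unfolding h_def y_def by (intro continuous_intros cont) auto
  ultimately have h: "h \<tau> = 0" if "\<tau> \<in> {-1..1}" for \<tau>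
    using continuous_constant_on_closure[of "{-1<..<1::real}" h 0 \<tau>] that by simp
  have y_ends: "y 1 = 1" "y (-1) = 1" using ends by (simp_all add: y_def)
  have "(P 0 + Q 0) * (exp \<theta> - exp (- \<theta>)) = 0"
    using h[of 1] h[of "-1"] y_ends by (simp add: h_def algebra_simps)
  then have PQ0: "P 0 = - Q 0" using \<theta>(1) by auto
  then have W10: "W1 0 = 0" by (simp add: P_def Q_def y1_def y_def)
  have "2 * \<theta> = 2 * Q 0 * cosh \<theta>"
    using h[of 1] y_ends PQ0 by (simp add: h_def cosh_field_def algebra_simps)
  then have Q0: "Q 0 = load \<theta>" by (simp add: load_def field_simps)
  have yc: "y \<tau> = cosh (\<theta> * \<tau>) / cosh \<theta>" if "\<tau> \<in> {-1..1}" for \<tau>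
  proof -
    have "2 * \<theta> * y \<tau> = 2 * load \<theta> * cosh (\<theta> * \<tau>)"
      using h[OF that] PQ0 Q0 by (simp add: h_def cosh_field_def algebra_simps)
    then show ?thesis using \<theta>(1) by (simp add: load_def field_simps)
  qed
  have Wb: "W \<tau> = bubble \<theta> \<tau>" if "\<tau> \<in> {-1..1}" for \<tau>
  proof -
    have "- W \<tau> / 2 = ln (cosh (\<theta> * \<tau>) / cosh \<theta>)"
      using yc[OF that] ln_exp[of "- W \<tau> / 2"] by (simp add: y_def)
    then show ?thesis by (simp add: bubble_def ln_div)
  qed
    \<comment> \<open>The energy is evaluated at the midpoint, where the slope vanishes.\<close>
have "\<nu> * (cosh \<theta>)\<^sup>2 = 2 * \<theta>\<^sup>2"
    using \<theta>(2) W10 Wb[of 0] exp_bubble[of \<theta> 0] by (simp add: E_def)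
  then have "\<nu> = 2 * (load \<theta>)\<^sup>2"
    by (simp add: load_def power_divide field_simps)
  with \<theta>(1) Wb show thesis using that by blast
qed

section \<open>The bifurcation curve\<close>

text \<open>The derivative of \<open>\<theta> / cosh \<theta>\<close> has the sign of \<open>cosh \<theta> - \<theta> * sinh \<theta>\<close>, which is strictly
  decreasing for \<open>\<theta> \<ge> 0\<close> and changes sign between \<open>0\<close> and \<open>2\<close>.\<close>
lemma load_unimodal:
  obtains t where "t > 0"
    "\<And>x y. 0 \<le> x \<Longrightarrow> x < y \<Longrightarrow> y \<le> t \<Longrightarrow> load x < load y"
    "\<And>x y. t \<le> x \<Longrightarrow> x < y \<Longrightarrow> load y < load x"
proof -
  define h where "h \<theta> = cosh \<theta> - \<theta> * sinh \<theta>" for \<theta> :: real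
  have dh: "(h has_real_derivative - (\<theta> * cosh \<theta>)) (at \<theta>)" for \<theta>
    unfolding h_def by (auto intro!: derivative_eq_intros)
  have h_mono: "h y < h x" if "0 \<le> x" "x < y" for x y
  proof -
    have "h x > h y"
    proof (rule DERIV_neg_imp_decreasing_open[OF that(2)])
      fix \<theta> assume "x < \<theta>" "\<theta> < y"
      then show "\<exists>d. (h has_real_derivative d) (at \<theta>) \<and> d < 0"
        using dh[of \<theta>] that by (intro exI[of _ "- (\<theta> * cosh \<theta>)"]) auto
    next
      show "continuous_on {x..y} h"
        by (intro continuous_at_imp_continuous_on ballI DERIV_isCont[OF dh])
    qed
    then show ?thesis .
  qed
  have "h 2 < 0"
  proof -
    have "exp (-2) < (1::real)" by simp
    moreover have "exp (2::real) \<ge> 1 + 2" by (rule exp_ge_add_one_self)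
    ultimately show ?thesis unfolding h_def cosh_field_def sinh_field_def by argo
  qed
  moreover have "h 0 = 1" by (simp add: h_def)
  ultimately obtain t where t: "0 \<le> t" "t \<le> 2" "h t = 0"
    using IVT2[of h 2 0 0] DERIV_isCont[OF dh] by auto
  have "t > 0" using t \<open>h 0 = 1\<close> by (cases "t = 0") auto
  have dl: "(load has_real_derivative h \<theta> / (cosh \<theta>)\<^sup>2) (at \<theta>)" for \<theta>
    unfolding load_def h_def by (auto intro!: derivative_eq_intros simp: power2_eq_square)
  have cl: "continuous_on {x..y} load" for x y
    by (intro continuous_at_imp_continuous_on ballI DERIV_isCont[OF dl])
  show thesis
  proof (rule that[OF \<open>t > 0\<close>])
    fix x y :: real assume xy: "0 \<le> x" "x < y" "y \<le> t"
    show "load x < load y"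
    proof (rule DERIV_pos_imp_increasing_open[OF xy(2) _ cl])
      fix \<theta> assume "x < \<theta>" "\<theta> < y"
      then show "\<exists>d. (load has_real_derivative d) (at \<theta>) \<and> 0 < d"
        using dl[of \<theta>] h_mono[of \<theta> t] xy t by (intro exI[of _ "h \<theta> / (cosh \<theta>)\<^sup>2"]) auto
    qed
  next
    fix x y :: real assume xy: "t \<le> x" "x < y"
    show "load y < load x"
    proof (rule DERIV_neg_imp_decreasing_open[OF xy(2) _ cl])
      fix \<theta> assume "x < \<theta>" "\<theta> < y"
      then show "\<exists>d. (load has_real_derivative d) (at \<theta>) \<and> d < 0"
        using dl[of \<theta>] h_mono[of t \<theta>] xy t
        by (intro exI[of _ "h \<theta> / (cosh \<theta>)\<^sup>2"]) (auto simp: divide_neg_pos)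
    qed
  qed
qed

lemma load_pos: "\<theta> > 0 \<Longrightarrow> load \<theta> > 0"
  by (simp add: load_def)

lemma continuous_load: "isCont load \<theta>"
  unfolding load_def by (intro continuous_intros) auto

lemma load_tendsto_0: "(load \<longlongrightarrow> 0) at_top"
  unfolding load_def cosh_field_def by real_asymp

text \<open>The two inverse branches of the curve. On the lower one \<open>\<theta> = \<mu> * cosh \<theta>\<close> is at most
  \<open>\<mu> * cosh t\<close>; the upper one is unbounded because \<^const>\<open>load\<close> stays away from \<open>0\<close> on bounded
  parts of the decreasing range.\<close>
lemma load_branches:
  obtains t \<theta>1 \<theta>2 where "t > 0"
    "\<And>\<theta>. \<theta> > 0 \<Longrightarrow> load \<theta> \<le> load t"
    "\<And>\<theta>. \<theta> > 0 \<Longrightarrow> load \<theta> = load t \<Longrightarrow> \<theta> = t"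
    "\<And>\<mu>. 0 < \<mu> \<Longrightarrow> \<mu> < load t \<Longrightarrow> 0 < \<theta>1 \<mu> \<and> \<theta>1 \<mu> < \<theta>2 \<mu> \<and> load (\<theta>1 \<mu>) = \<mu> \<and> load (\<theta>2 \<mu>) = \<mu>"
    "\<And>\<mu> \<theta>. 0 < \<mu> \<Longrightarrow> \<mu> < load t \<Longrightarrow> \<theta> > 0 \<Longrightarrow> load \<theta> = \<mu> \<Longrightarrow> \<theta> = \<theta>1 \<mu> \<or> \<theta> = \<theta>2 \<mu>"
    "(\<theta>1 \<longlongrightarrow> 0) (at_right 0)" "filterlim \<theta>2 at_top (at_right 0)"
proof -
  obtain t where t: "t > 0" 
    and inc: "\<And>x y. 0 \<le> x \<Longrightarrow> x < y \<Longrightarrow> y \<le> t \<Longrightarrow> load x < load y"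
    and dec: "\<And>x y. t \<le> x \<Longrightarrow> x < y \<Longrightarrow> load y < load x"
    using load_unimodal by blast
  have ex1: "\<exists>\<theta>. 0 < \<theta> \<and> \<theta> < t \<and> load \<theta> = \<mu>" if \<mu>: "0 < \<mu>" "\<mu> < load t" for \<mu>
  proof -
    have load_0: "load 0 = 0" by (simp add: load_def)
    then obtain \<theta> where "0 \<le> \<theta>" "\<theta> \<le> t" "load \<theta> = \<mu>"
      using IVT[of load 0 \<mu> t] \<mu> t continuous_load by auto
    then show ?thesis using \<mu> load_0
      by (intro exI[of _ \<theta>]) (cases "\<theta> = t"; cases "\<theta> = 0"; simp)
  qed
  have ex2: "\<exists>\<theta>. t < \<theta> \<and> load \<theta> = \<mu>" if \<mu>: "0 < \<mu>" "\<mu> < load t" for \<mu>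
  proof -
    have "eventually (\<lambda>\<theta>. load \<theta> < \<mu> \<and> t < \<theta>) at_top"
      using order_tendstoD(2)[OF load_tendsto_0 \<mu>(1)] eventually_gt_at_top[of t]
      by eventually_elim auto
    from eventually_happens'[OF trivial_limit_at_top_linorder this]
    obtain K where "load K < \<mu>" "t < K" by blast
    then obtain \<theta> where "t \<le> \<theta>" "load \<theta> = \<mu>"
      using IVT2[of load K \<mu> t] \<mu> continuous_load by auto
    then show ?thesis using \<mu> by (intro exI[of _ \<theta>]) (cases "\<theta> = t"; simp)
  qed
  define \<theta>1 where "\<theta>1 \<mu> = (SOME \<theta>. 0 < \<theta> \<and> \<theta> < t \<and> load \<theta> = \<mu>)" for \<mu>
  define \<theta>2 where "\<theta>2 \<mu> = (SOME \<theta>. t < \<theta> \<and> load \<theta> = \<mu>)" for \<mu>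
  have \<theta>1: "0 < \<theta>1 \<mu> \<and> \<theta>1 \<mu> < t \<and> load (\<theta>1 \<mu>) = \<mu>" if "0 < \<mu>" "\<mu> < load t" for \<mu>
    unfolding \<theta>1_def using someI_ex[OF ex1[OF that]] .
  have \<theta>2: "t < \<theta>2 \<mu> \<and> load (\<theta>2 \<mu>) = \<mu>" if "0 < \<mu>" "\<mu> < load t" for \<mu>
    unfolding \<theta>2_def using someI_ex[OF ex2[OF that]] .
  have small: "eventually (\<lambda>\<mu>. 0 < \<mu> \<and> \<mu> < c) (at_right (0::real))" if "c > 0" for c
    using eventually_at_right[OF that] that by auto
  show thesis
  proof (rule that[of t \<theta>1 \<theta>2])
    show "load \<theta> \<le> load t" "load \<theta> = load t \<Longrightarrow> \<theta> = t" if "\<theta> > 0" for \<theta>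
      using inc[of \<theta> t] dec[of t \<theta>] that by (cases \<theta> t rule: linorder_cases; auto)+
    show "0 < \<theta>1 \<mu> \<and> \<theta>1 \<mu> < \<theta>2 \<mu> \<and> load (\<theta>1 \<mu>) = \<mu> \<and> load (\<theta>2 \<mu>) = \<mu>"
      if "0 < \<mu>" "\<mu> < load t" for \<mu>
      using \<theta>1[OF that] \<theta>2[OF that] by auto
    show "\<theta> = \<theta>1 \<mu> \<or> \<theta> = \<theta>2 \<mu>"
      if "0 < \<mu>" "\<mu> < load t" "\<theta> > 0" "load \<theta> = \<mu>" for \<mu> \<theta>
      using \<theta>1[OF that(1,2)] \<theta>2[OF that(1,2)] inc[of \<theta> "\<theta>1 \<mu>"] inc[of "\<theta>1 \<mu>" \<theta>]
        dec[of \<theta> "\<theta>2 \<mu>"] dec[of "\<theta>2 \<mu>" \<theta>] that(3,4)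
      by (smt (verit))
    show "(\<theta>1 \<longlongrightarrow> 0) (at_right 0)"
    proof (rule real_tendsto_sandwich)
      show "eventually (\<lambda>\<mu>. 0 \<le> \<theta>1 \<mu>) (at_right 0)"
        using small[OF load_pos[OF t]] by eventually_elim (use \<theta>1 in force)
      show "eventually (\<lambda>\<mu>. \<theta>1 \<mu> \<le> \<mu> * cosh t) (at_right 0)"
        using small[OF load_pos[OF t]]
      proof eventually_elim
        case (elim \<mu>)
        then have *: "0 < \<theta>1 \<mu>" "\<theta>1 \<mu> < t" "load (\<theta>1 \<mu>) = \<mu>" using \<theta>1 by auto
        then have "\<theta>1 \<mu> = \<mu> * cosh (\<theta>1 \<mu>)" by (simp add: load_def field_simps)
        also have "\<dots> \<le> \<mu> * cosh t"
          using * elim t by (intro mult_left_mono) (auto simp: cosh_real_nonneg_le_iff)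
        finally show ?case .
      qed
      show "((\<lambda>\<mu>. \<mu> * cosh t) \<longlongrightarrow> 0) (at_right 0)"
        by (auto intro!: tendsto_eq_intros)
    qed simp
    show "filterlim \<theta>2 at_top (at_right 0)"
      unfolding filterlim_at_top_ge[of _ _ t]
    proof (intro allI impI)
      fix K assume K: "t \<le> K"
      then have "0 < min (load K) (load t)" using t load_pos by auto
      from small[OF this] show "eventually (\<lambda>\<mu>. K \<le> \<theta>2 \<mu>) (at_right 0)"
      proof eventually_elim
        case (elim \<mu>)
        then have *: "t < \<theta>2 \<mu>" "load (\<theta>2 \<mu>) = \<mu>" using \<theta>2 by auto
        then show ?case using dec[of "\<theta>2 \<mu>" K] elim by (cases "\<theta>2 \<mu> < K") auto
      qed
    qed
  qed (use t in auto)
qed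

section \<open>Essential suprema, integrals and local convergence\<close>

text \<open>If the essential supremum were below the attained maximum, a nonempty open set of points with
  larger values would be negligible.\<close>
lemma Linf_norm_attained:
  fixes u :: "'a::euclidean_space \<Rightarrow> real"
  assumes S: "open S" and u: "continuous_on S u" and le: "\<And>x. x \<in> S \<Longrightarrow> \<bar>u x\<bar> \<le> M"
    and x0: "x0 \<in> S" "\<bar>u x0\<bar> = M"
  shows "Linf_norm S u = M"
proof -
  have "esssup (lebesgue_on S) (\<lambda>x. ereal \<bar>u x\<bar>) = ereal M"
  proof (rule antisym)
    have "(\<lambda>x. \<bar>u x\<bar>) \<in> borel_measurable (lebesgue_on S)"
      using S u by (intro continuous_imp_measurable_on_sets_lebesgue continuous_intros) auto
    then show "esssup (lebesgue_on S) (\<lambda>x. ereal \<bar>u x\<bar>) \<le> ereal M"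
      using le by (intro esssup_I AE_I2) auto
    show "ereal M \<le> esssup (lebesgue_on S) (\<lambda>x. ereal \<bar>u x\<bar>)"
    proof (rule ccontr)
      assume "\<not> ?thesis"
      then obtain c where c: "esssup (lebesgue_on S) (\<lambda>x. ereal \<bar>u x\<bar>) < ereal c" "c < M"
        using ereal_dense2[of _ "ereal M"] by (auto simp: not_le)
      define T where "T = (\<lambda>x. \<bar>u x\<bar>) -` {c<..} \<inter> S"
      have "continuous_on S (\<lambda>x. \<bar>u x\<bar>)" by (intro continuous_intros u)
      then have "open T"
        unfolding T_def continuous_on_open_vimage[OF S] by simp
      moreover have "x0 \<in> T" using x0 c by (simp add: T_def)
      moreover have "negligible T"
      proof -
        have "AE x in lebesgue_on S. \<bar>u x\<bar> \<le> c"
          using esssup_AE[of "\<lambda>x. ereal \<bar>u x\<bar>" "lebesgue_on S"]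
          by eventually_elim (metis c(1) ereal_less_eq(3) less_imp_le order_trans)
        then have "AE x in lebesgue. x \<in> S \<longrightarrow> \<bar>u x\<bar> \<le> c"
          using S by (subst (asm) AE_restrict_space_iff) auto
        then have "{x. \<not> (x \<in> S \<longrightarrow> \<bar>u x\<bar> \<le> c)} \<in> null_sets lebesgue"
          by (simp add: completion.AE_iff_null_sets)
        moreover have "{x. \<not> (x \<in> S \<longrightarrow> \<bar>u x\<bar> \<le> c)} = T" by (auto simp: T_def)
        ultimately show ?thesis by (simp add: negligible_iff_null_sets)
      qed
      ultimately show False using open_not_negligible by blast
    qed
  qed
  then show ?thesis by (simp add: Linf_norm_def)
qed

lemma set_integrable_lebesgue_compact:
  fixes g :: "'a::euclidean_space \<Rightarrow> real"
  assumes "compact K" "continuous_on K g" "A \<subseteq> K" "A \<in> sets lebesgue"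
  shows "set_integrable lebesgue A g"
proof -
  have "integrable lborel (\<lambda>x. indicator K x *\<^sub>R g x)"
    by (rule borel_integrable_compact[OF assms(1,2)])
  then have "set_integrable lebesgue K g"
    unfolding set_integrable_def
    by (subst integrable_completion) (auto dest: borel_measurable_integrable)
  then show ?thesis using set_integrable_subset assms(3,4) by blast
qed

lemma content_ball_diff_ge:
  fixes r h :: real
  assumes "0 \<le> r" "0 \<le> h"
  shows "unit_ball_vol (real DIM('a)) * (r ^ (DIM('a) - 1) * h)
    \<le> measure lebesgue (ball 0 (r + h) - ball 0 r :: 'a::euclidean_space set)"
proof -
  obtain k where k: "DIM('a) = Suc k" using DIM_positive[where 'a='a] by (cases "DIM('a)") auto
  have "measure lebesgue (ball 0 (r + h) - ball 0 r :: 'a set)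
      = measure lborel (ball (0::'a) (r + h)) - measure lborel (ball (0::'a) r)"
    using assms by (subst measurable_measure_Diff) (auto intro: subset_ball)
  also have "\<dots> = unit_ball_vol (real DIM('a)) * ((r + h) ^ DIM('a) - r ^ DIM('a))"
    using assms by (simp add: content_ball right_diff_distrib)
  finally have eq: "measure lebesgue (ball 0 (r + h) - ball 0 r :: 'a set) = \<dots>" .
  have "(r + h) * r ^ k \<le> (r + h) * (r + h) ^ k"
    using assms by (intro mult_left_mono power_mono) auto
  then have "r ^ k * h \<le> (r + h) ^ DIM('a) - r ^ DIM('a)"
    by (simp add: k algebra_simps)
  then show ?thesis
    unfolding eq by (intro mult_left_mono) (auto simp: k)
qed

lemma radial_profile_norm:
  assumes "\<And>x::'a::euclidean_space. u x = f (norm x)" "0 \<le> r"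
  shows "radial_profile u r = f r"
proof -
  obtain x :: 'a where "norm x = r" using vector_choose_size[OF assms(2)] by blast
  then have "u ` sphere 0 r = {f r}" using assms(1) by (auto simp: image_iff)
  then show ?thesis by (simp add: radial_profile_def)
qed

text \<open>Convergence of functions that agree with their limit on their entire, growing domains. The
  domains are open, so the derivatives agree too.\<close>
lemma C1_loc_limit_eventually_eq:
  fixes f :: "'b \<Rightarrow> real \<Rightarrow> real"
  assumes opn: "\<And>l. open (I l)" and eq: "\<forall>\<^sub>F l in F. \<forall>t\<in>I l. f l t = g t"
    and g: "g C1_differentiable_on UNIV" and sub: "\<And>K. compact K \<Longrightarrow> \<forall>\<^sub>F l in F. K \<subseteq> I l"
  shows "C1_loc_limit I f g F"
proof -
  obtain D where D: "\<And>t. (g has_vector_derivative D t) (at t)" "continuous_on UNIV D"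
    using g unfolding C1_differentiable_on_def by auto
  have fD: "(f l has_vector_derivative D t) (at t)" if "\<forall>t\<in>I l. f l t = g t" "t \<in> I l" for l t
    using has_vector_derivative_transform_within_open[OF D(1)[of t] opn that(2)] that(1) by auto
  have der: "deriv (f l) t = D t" "deriv g t = D t" if "\<forall>t\<in>I l. f l t = g t" "t \<in> I l" for l t
    using fD[OF that] D(1)[of t] DERIV_imp_deriv has_real_derivative_iff_has_vector_derivative by blast+
  show ?thesis
    unfolding C1_loc_limit_def
  proof (intro conjI allI impI g)
    show "\<forall>\<^sub>F l in F. f l C1_differentiable_on I l"
      using eq
    proof eventually_elim
      case (elim l)
      then show ?case
        using fD D(2) continuous_on_subset unfolding C1_differentiable_on_def by blast
    qed
    fix K :: "real set" assume "compact K"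
    from sub[OF this] show K: "\<forall>\<^sub>F l in F. K \<subseteq> I l" .
    show "uniform_limit K f g F"
    proof (rule uniform_limitI)
      fix e :: real assume "0 < e"
      show "\<forall>\<^sub>F l in F. \<forall>t\<in>K. dist (f l t) (g t) < e"
        using K eq by eventually_elim (use \<open>0 < e\<close> in auto)
    qed
    show "uniform_limit K (\<lambda>l. deriv (f l)) (deriv g) F"
    proof (rule uniform_limitI)
      fix e :: real assume "0 < e"
      show "\<forall>\<^sub>F l in F. \<forall>t\<in>K. dist (deriv (f l) t) (deriv g t) < e"
        using K eq
      proof eventually_elim
        case (elim l)
        then show ?case using der[OF elim(2)] \<open>0 < e\<close> by (auto simp: subset_iff)
      qed
    qed
  qed
qed

text \<open>The limit profile in the form in which the rescaled solutions appear.\<close>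
lemma ln_sigmoid_eq_ln_cosh:
  "ln (4 * exp (sqrt 2 * t) / (1 + exp (sqrt 2 * t))\<^sup>2) = - 2 * ln (cosh (t / sqrt 2))"
proof -
  define s where "s = t / sqrt 2"
  have double: "sqrt 2 * t = s + s"
    by (simp add: s_def field_simps)
  have e: "exp (sqrt 2 * t) = exp s * exp s" unfolding double exp_add ..
  have "1 + exp s * exp s = exp s * (2 * cosh s)"
    using exp_minus_inverse[of s] by (simp add: cosh_field_def algebra_simps)
  then have "4 * exp (sqrt 2 * t) / (1 + exp (sqrt 2 * t))\<^sup>2 = 1 / (cosh s)\<^sup>2"
    unfolding e by (simp add: power2_eq_square)
  then show ?thesis by (simp add: ln_div ln_realpow s_def)
qed

lemma sigmoid_C1: "(\<lambda>t. ln (4 * exp (sqrt 2 * t) / (1 + exp (sqrt 2 * t))\<^sup>2)) C1_differentiable_on UNIV"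
proof -
  let ?D = "\<lambda>t::real. - 2 * (sinh (t / sqrt 2) / sqrt 2 / cosh (t / sqrt 2))"
  have "((\<lambda>t. - 2 * ln (cosh (t / sqrt 2))) has_vector_derivative ?D t) (at t)" for t
    unfolding has_real_derivative_iff_has_vector_derivative[symmetric]
    by (auto intro!: derivative_eq_intros simp: field_simps)
  moreover have "continuous_on UNIV ?D"
    by (intro continuous_intros) auto
  ultimately show ?thesis
    unfolding ln_sigmoid_eq_ln_cosh C1_differentiable_on_def by (intro exI[of _ ?D]) simp
qed

section \<open>Harmonic coordinate and classification of the radial solutions\<close>

text \<open>On the shell \<open>a \<le> r \<le> b\<close> the coordinate is \<open>r powr (2 - n)\<close>, shifted and scaled so that it
  takes the value \<open>1\<close> at \<open>a\<close>, \<open>-1\<close> at \<open>b\<close>, and \<open>0\<close> at the midpoint that enters the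
  rescaling and the Green's function.\<close>
locale annular_shell =
  fixes a b :: real and n :: nat
  assumes a_pos: "0 < a" and a_less_b: "a < b" and n_ge: "3 \<le> n"
begin

definition mid :: real where
  "mid = (a powr (2 - real n) + b powr (2 - real n)) / 2"

definition halfwidth :: real where
  "halfwidth = (a powr (2 - real n) - b powr (2 - real n)) / 2"

definition coord :: "real \<Rightarrow> real" where
  "coord r = (r powr (2 - real n) - mid) / halfwidth"

definition radius :: "real \<Rightarrow> real" where
  "radius \<tau> = (mid + halfwidth * \<tau>) powr (1 / (2 - real n))"

lemma powr_antimono: "0 < r \<Longrightarrow> r < s \<Longrightarrow> s powr (2 - real n) < r powr (2 - real n)"
  using n_ge powr_less_mono2_neg by auto

lemma halfwidth_pos: "0 < halfwidth"
  using powr_antimono[OF a_pos a_less_b] by (simp add: halfwidth_def)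

lemma mid_bounds: "mid - halfwidth = b powr (2 - real n)" "mid + halfwidth = a powr (2 - real n)"
  by (simp_all add: mid_def halfwidth_def field_simps)

lemma coord_ends: "coord a = 1" "coord b = - 1"
  using halfwidth_pos mid_bounds by (simp_all add: coord_def field_simps)

lemma coord_antimono: "0 < r \<Longrightarrow> r < s \<Longrightarrow> coord s < coord r"
  using powr_antimono halfwidth_pos by (simp add: coord_def divide_strict_right_mono)

lemma abs_coord_le_1: "a \<le> r \<Longrightarrow> r \<le> b \<Longrightarrow> \<bar>coord r\<bar> \<le> 1"
  using coord_antimono[of a r] coord_antimono[of r b] coord_ends a_pos
  by (cases "a = r"; cases "r = b") auto

lemma radius_arg_pos: "\<tau> \<in> {-1..1} \<Longrightarrow> 0 < mid + halfwidth * \<tau>"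
proof -
  assume "\<tau> \<in> {-1..1}"
  then have "halfwidth * (-1) \<le> halfwidth * \<tau>"
    using halfwidth_pos by (intro mult_left_mono) auto
  then have "b powr (2 - real n) \<le> mid + halfwidth * \<tau>"
    using mid_bounds(1) by simp
  moreover have "0 < b powr (2 - real n)" using a_pos a_less_b by simp
  ultimately show ?thesis by linarith
qed

lemma radius_coord: "0 < r \<Longrightarrow> radius (coord r) = r"
  using halfwidth_pos n_ge by (simp add: radius_def coord_def powr_powr)

lemma coord_radius: "\<tau> \<in> {-1..1} \<Longrightarrow> coord (radius \<tau>) = \<tau>"
  using halfwidth_pos n_ge radius_arg_pos[of \<tau>] by (simp add: radius_def coord_def powr_powr)

lemma radius_pos: "\<tau> \<in> {-1..1} \<Longrightarrow> 0 < radius \<tau>"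
  using radius_arg_pos[of \<tau>] by (simp add: radius_def)

lemma radius_ends: "radius 1 = a" "radius (- 1) = b"
  using radius_coord[of a] radius_coord[of b] coord_ends a_pos a_less_b by simp_all

lemma radius_mem: "\<tau> \<in> {-1<..<1} \<Longrightarrow> radius \<tau> \<in> {a<..<b}"
  using coord_antimono[of "radius \<tau>" a] coord_antimono[of b "radius \<tau>"] a_pos a_less_b
    coord_radius[of \<tau>] coord_ends radius_pos[of \<tau>]
  by (cases "radius \<tau>" a rule: linorder_cases; cases "radius \<tau>" b rule: linorder_cases) auto

lemma radius_mem_closed: "\<tau> \<in> {-1..1} \<Longrightarrow> radius \<tau> \<in> {a..b}"
  using radius_mem[of \<tau>] radius_ends a_less_b by (cases "\<tau> = 1"; cases "\<tau> = -1") auto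

text \<open>The constant factor in \<open>radius' = speed * radius ^ (n - 1)\<close>; it is negative, as the coordinate
  decreases with the radius.\<close>
definition speed :: real where
  "speed = halfwidth / (2 - real n)"

lemma speed_neq_0: "speed \<noteq> 0"
  using halfwidth_pos n_ge by (simp add: speed_def)

lemma power_pred_deriv:
  assumes "0 < r"
  shows "((\<lambda>r. r ^ (n - 1)) has_real_derivative (real n - 1) * r ^ (n - 1) / r) (at r)"
proof -
  have "n - 1 = Suc (n - 1 - 1)" using n_ge by simp
  then have "r ^ (n - 1) = r * r ^ (n - 1 - 1)" by (metis power_Suc)
  then show ?thesis
    using assms n_ge by (auto intro!: derivative_eq_intros simp: of_nat_diff)
qed

lemma coord_deriv:
  assumes "0 < r"
  shows "(coord has_real_derivative 1 / (speed * r ^ (n - 1))) (at r)"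
proof -
  have "r powr (2 - real n - 1) = 1 / r ^ (n - 1)"
    using assms n_ge powr_minus[of r "real (n - 1)"] powr_realpow[OF assms, of "n - 1"]
    by (simp add: of_nat_diff divide_inverse)
  moreover have "(coord has_real_derivative (2 - real n) * r powr (2 - real n - 1) / halfwidth) (at r)"
    unfolding coord_def using assms halfwidth_pos by (auto intro!: derivative_eq_intros)
  ultimately show ?thesis by (simp add: speed_def mult.commute)
qed

lemma radius_deriv:
  assumes "\<tau> \<in> {-1..1}"
  shows "(radius has_real_derivative speed * radius \<tau> ^ (n - 1)) (at \<tau>)"
proof -
  let ?s = "mid + halfwidth * \<tau>"
  have s: "0 < ?s" by (rule radius_arg_pos[OF assms])
  have e: "1 / (2 - real n) * real (n - 1) = 1 / (2 - real n) - 1"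
    using n_ge by (simp add: of_nat_diff field_simps)
  have "radius \<tau> ^ (n - 1) = radius \<tau> powr real (n - 1)"
    by (rule powr_realpow[OF radius_pos[OF assms], symmetric])
  also have "\<dots> = ?s powr (1 / (2 - real n) - 1)"
    unfolding radius_def powr_powr e ..
  finally have "radius \<tau> ^ (n - 1) = ?s powr (1 / (2 - real n) - 1)" .
  moreover have "(radius has_real_derivative
      1 / (2 - real n) * ?s powr (1 / (2 - real n) - 1) * halfwidth) (at \<tau>)"
    unfolding radius_def using s by (auto intro!: derivative_eq_intros)
  ultimately show ?thesis by (simp add: speed_def mult_ac)
qed

lemma continuous_on_coord: "continuous_on {a..b} coord"
  using a_pos by (intro continuous_at_imp_continuous_on ballI DERIV_isCont[OF coord_deriv]) auto

lemma continuous_on_radius: "continuous_on {-1..1} radius"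
  by (intro continuous_at_imp_continuous_on ballI DERIV_isCont[OF radius_deriv])

definition radial_bubble :: "real \<Rightarrow> 'a::real_normed_vector \<Rightarrow> real" where
  "radial_bubble \<theta> x = bubble \<theta> (coord (norm x))"

text \<open>The value of the parameter of the elliptic problem for which \<open>radial_bubble \<theta>\<close> is a solution.\<close>
definition lam_of :: "real \<Rightarrow> real" where
  "lam_of \<theta> = 2 * (load \<theta> / halfwidth)\<^sup>2"

lemma closure_shell: "closure (annulus a b :: 'a::euclidean_space set) = {x. a \<le> norm x \<and> norm x \<le> b}"
  by (rule closure_annulus[OF a_pos a_less_b])

lemma continuous_on_radial_bubble:
  "continuous_on (closure (annulus a b)) (radial_bubble \<theta> :: 'a::euclidean_space \<Rightarrow> real)"
proof -
  have "continuous_on UNIV (bubble \<theta>)"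
    by (intro continuous_at_imp_continuous_on ballI DERIV_isCont[OF bubble_deriv])
  then show ?thesis
    unfolding radial_bubble_def closure_shell
    by (rule continuous_on_compose2)
       (auto intro!: continuous_intros continuous_on_compose2[OF continuous_on_coord])
qed

text \<open>In \<open>f'' + (n - 1) / r * f'\<close> for \<open>f r = bubble \<theta> (coord r)\<close> the terms with the first derivative of
  the bubble cancel, because the coordinate is a harmonic function of \<open>x\<close>. What remains is the second
  derivative of the bubble times the squared derivative of the coordinate, and the latter carries the
  weight of the equation.\<close>
lemma radial_solution_radial_bubble:
  assumes n: "n = DIM('a::euclidean_space)"
  shows "radial_solution a b (lam_of \<theta>) (radial_bubble \<theta> :: 'a \<Rightarrow> real)"
proof -
  define B1 where "B1 \<tau> = - 2 * \<theta> * sinh (\<theta> * \<tau>) / cosh (\<theta> * \<tau>)" for \<tau>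
  define B2 where "B2 \<tau> = - (2 * (load \<theta>)\<^sup>2 * exp (bubble \<theta> \<tau>))" for \<tau>
  define f where "f r = bubble \<theta> (coord r)" for r
  define c where "c r = 1 / (speed * r ^ (n - 1))" for r
  define f1 where "f1 r = B1 (coord r) * c r" for r
  define f2 where "f2 r = B2 (coord r) * c r ^ 2 - B1 (coord r) * (real n - 1) * c r / r" for r
  have B1: "(bubble \<theta> has_real_derivative B1 \<tau>) (at \<tau>)"
    and B2: "(B1 has_real_derivative B2 \<tau>) (at \<tau>)" for \<tau>
    unfolding B1_def B2_def by (rule bubble_deriv bubble_deriv2)+
  have cd: "(coord has_real_derivative c r) (at r)" if "0 < r" for r
    unfolding c_def by (rule coord_deriv[OF that])
  have c': "(c has_real_derivative - ((real n - 1) * c r / r)) (at r)" if "0 < r" for r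
  proof -
    define p where "p r = r ^ (n - 1)" for r :: real
    have p: "(p has_real_derivative (real n - 1) * p r / r) (at r)"
      unfolding p_def by (rule power_pred_deriv[OF that])
    have "p r \<noteq> 0" using that by (simp add: p_def)
    then show ?thesis
      unfolding c_def p_def[symmetric] using that speed_neq_0 p
      by (auto intro!: derivative_eq_intros simp: field_simps power2_eq_square)
  qed
  have f: "(f has_real_derivative f1 r) (at r)" if "r \<in> {a<..<b}" for r
    unfolding f_def f1_def using that a_pos by (intro DERIV_chain2[OF B1 cd]) auto
  have f1: "(f1 has_real_derivative f2 r) (at r)" if "r \<in> {a<..<b}" for r
  proof -
    have r: "0 < r" using that a_pos by auto
    show ?thesis
      unfolding f1_def f2_def
      by (rule DERIV_cong[OF DERIV_mult[OF DERIV_chain2[OF B2 cd[OF r]] c'[OF r]]])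
         (simp add: power2_eq_square)
  qed
  have "continuous_on UNIV B1" "continuous_on UNIV (bubble \<theta>)"
    by (intro continuous_at_imp_continuous_on ballI DERIV_isCont[OF B2] DERIV_isCont[OF B1])+
  moreover have "continuous_on {a<..<b} coord"
    by (rule continuous_on_subset[OF continuous_on_coord]) auto
  ultimately have "continuous_on {a<..<b} (\<lambda>r. B1 (coord r))"
      "continuous_on {a<..<b} (\<lambda>r. bubble \<theta> (coord r))"
    by (auto intro: continuous_on_compose2)
  then have "continuous_on {a<..<b} f2"
    unfolding f2_def B2_def c_def using a_pos speed_neq_0
    by (intro continuous_intros) auto
  then have C2: "C2_on (annulus a b) (\<lambda>x::'a. f (norm x))"
    and lap: "\<And>x::'a. x \<in> annulus a b \<Longrightarrow> laplacian (\<lambda>x. f (norm x)) x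
           = f2 (norm x) + (real DIM('a) - 1) / norm x * f1 (norm x)"
    using C2_on_comp_norm[OF less_imp_le[OF a_pos] f f1] by blast+
  have bubble_f: "radial_bubble \<theta> = (\<lambda>x::'a. f (norm x))"
    by (simp add: fun_eq_iff radial_bubble_def f_def)
  have eq: "- laplacian (radial_bubble \<theta>) x
      = lam_of \<theta> * (real DIM('a) - 2)\<^sup>2 * exp (radial_bubble \<theta> x) / norm x ^ (2 * (DIM('a) - 1))"
    if x: "x \<in> annulus a b" for x :: 'a
  proof -
    have r: "0 < norm x" using x a_pos by (auto simp: annulus_def)
    have "laplacian (radial_bubble \<theta>) x = B2 (coord (norm x)) * c (norm x) ^ 2"
      unfolding bubble_f lap[OF x] using n by (simp add: f2_def f1_def algebra_simps)
    also have "\<dots> = - (lam_of \<theta> * (real n - 2)\<^sup>2 * exp (radial_bubble \<theta> x) / (norm x ^ (n - 1))\<^sup>2)"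
      using halfwidth_pos n_ge r
      by (simp add: B2_def c_def lam_of_def radial_bubble_def speed_def power_divide
          power_mult_distrib power2_commute[of 2])
    finally show ?thesis using n by (simp add: power_mult[symmetric] mult.commute)
  qed
  show ?thesis
    unfolding radial_solution_def solution_def frontier_annulus[OF a_pos a_less_b]
  proof (intro conjI ballI)
    show "C2_on (annulus a b) (radial_bubble \<theta> :: 'a \<Rightarrow> real)"
      unfolding bubble_f by (rule C2)
    show "radial_bubble \<theta> x = 0" if "x \<in> {x. norm x = a \<or> norm x = b}" for x :: 'a
    proof -
      have "coord (norm x) = 1 \<or> coord (norm x) = - 1" using that coord_ends by auto
      then show ?thesis using bubble_ends[of \<theta>] by (auto simp: radial_bubble_def)
    qed
    show "radial_on (closure (annulus a b)) (radial_bubble \<theta> :: 'a \<Rightarrow> real)"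
      by (simp add: radial_on_def radial_bubble_def)
  qed (use eq continuous_on_radial_bubble in auto)
qed

text \<open>The same computation in the opposite direction: in the harmonic coordinate a radial solution
  satisfies the one-dimensional Liouville problem with \<open>\<nu> = lam * halfwidth\<^sup>2\<close>, whose solutions are
  known.\<close>
lemma radial_solution_imp_radial_bubble:
  fixes w :: "'a::euclidean_space \<Rightarrow> real"
  assumes n: "n = DIM('a)" and lam: "0 < lam" and w: "radial_solution a b lam w"
  obtains \<theta> where "0 < \<theta>" "lam = lam_of \<theta>" "eq_on (closure (annulus a b)) w (radial_bubble \<theta>)"
proof -
  obtain i :: 'a where i: "i \<in> Basis" using nonempty_Basis by blast
  let ?A = "annulus a b :: 'a set"
  have C2: "C2_on ?A w" and cont: "continuous_on (closure ?A) w"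
    and pde: "\<And>x. x \<in> ?A \<Longrightarrow> - laplacian w x =
        lam * (real DIM('a) - 2)\<^sup>2 * exp (w x) / norm x ^ (2 * (DIM('a) - 1))"
    and bc: "\<And>x. norm x = a \<or> norm x = b \<Longrightarrow> w x = 0"
    and rad: "radial_on (closure ?A) w"
    using w by (auto simp: radial_solution_def solution_def frontier_annulus[OF a_pos a_less_b])
  have "radial_on ?A w"
    using rad closure_subset[of ?A] unfolding radial_on_def by (meson subsetD)
  from C2_on_radial_imp_profile[OF less_imp_le[OF a_pos] C2 this i]
  obtain f1 f2 where
    f: "\<And>r. r \<in> {a<..<b} \<Longrightarrow> ((\<lambda>r. w (r *\<^sub>R i)) has_real_derivative f1 r) (at r)"
    and f1: "\<And>r. r \<in> {a<..<b} \<Longrightarrow> (f1 has_real_derivative f2 r) (at r)"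
    and lap: "\<And>r. r \<in> {a<..<b} \<Longrightarrow> laplacian w (r *\<^sub>R i) = f2 r + (real DIM('a) - 1) / r * f1 r"
    by blast
  define W where "W \<tau> = w (radius \<tau> *\<^sub>R i)" for \<tau>
  define W1 where "W1 \<tau> = f1 (radius \<tau>) * (speed * radius \<tau> ^ (n - 1))" for \<tau>
  have W: "(W has_real_derivative W1 \<tau>) (at \<tau>)" if "\<tau> \<in> {-1<..<1}" for \<tau>
    unfolding W_def W1_def using that
    by (intro DERIV_chain2[OF f[OF radius_mem[OF that]] radius_deriv]) auto
  have W1: "(W1 has_real_derivative - (lam * halfwidth\<^sup>2 * exp (W \<tau>))) (at \<tau>)"
    if \<tau>: "\<tau> \<in> {-1<..<1}" for \<tau>
  proof -
    define R where "R = radius \<tau>"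
    have R: "R \<in> {a<..<b}" "0 < R" using radius_mem[OF \<tau>] a_pos by (auto simp: R_def)
    have dR: "(radius has_real_derivative speed * R ^ (n - 1)) (at \<tau>)"
      unfolding R_def using \<tau> by (intro radius_deriv) auto
    have "((\<lambda>\<tau>. speed * radius \<tau> ^ (n - 1)) has_real_derivative
        speed * ((real n - 1) * R ^ (n - 1) / R * (speed * R ^ (n - 1)))) (at \<tau>)"
      using DERIV_cmult[OF DERIV_chain2[OF power_pred_deriv[OF R(2), unfolded R_def] dR[unfolded R_def]], of speed]
      by (simp add: R_def)
    from DERIV_mult[OF DERIV_chain2[OF f1[OF R(1), unfolded R_def] dR[unfolded R_def]] this]
    have "(W1 has_real_derivative
        (f2 R + (real n - 1) / R * f1 R) * (speed * R ^ (n - 1))\<^sup>2) (at \<tau>)"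
      unfolding W1_def R_def[symmetric]
      by (rule DERIV_cong) (simp add: power2_eq_square algebra_simps)
    also have "f2 R + (real n - 1) / R * f1 R = laplacian w (R *\<^sub>R i)"
      using lap[OF R(1)] n by simp
    also have "\<dots> = - (lam * (real n - 2)\<^sup>2 * exp (W \<tau>) / (R ^ (n - 1))\<^sup>2)"
    proof -
      have "norm (R *\<^sub>R i) = R" using R(2) i by simp
      then have "- laplacian w (R *\<^sub>R i)
          = lam * (real n - 2)\<^sup>2 * exp (W \<tau>) / R ^ (2 * (n - 1))"
        using pde[of "R *\<^sub>R i"] R(1) n by (simp add: annulus_def W_def R_def)
      then show ?thesis by (simp add: power_mult[symmetric] mult.commute)
    qed
    also have "\<dots> * (speed * R ^ (n - 1))\<^sup>2 = - (lam * halfwidth\<^sup>2 * exp (W \<tau>))"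
      using R(2) n_ge
      by (simp add: speed_def power_divide power_mult_distrib power2_commute[of 2])
    finally show ?thesis .
  qed
  have "continuous_on {-1..1} W"
    unfolding W_def
  proof (rule continuous_on_compose2[OF cont])
    show "continuous_on {-1..1} (\<lambda>\<tau>. radius \<tau> *\<^sub>R i)"
      by (intro continuous_intros continuous_on_radius)
    show "(\<lambda>\<tau>. radius \<tau> *\<^sub>R i) ` {-1..1} \<subseteq> closure ?A"
      using radius_mem_closed i a_pos by (force simp: closure_shell)
  qed
  moreover have "W (-1) = 0" "W 1 = 0"
    using i a_pos a_less_b by (auto simp: W_def radius_ends intro!: bc)
  moreover have "0 < lam * halfwidth\<^sup>2" using lam halfwidth_pos by simp
  ultimately obtain \<theta> where \<theta>: "0 < \<theta>" "lam * halfwidth\<^sup>2 = 2 * (load \<theta>)\<^sup>2"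
      "\<And>\<tau>. \<tau> \<in> {-1..1} \<Longrightarrow> W \<tau> = bubble \<theta> \<tau>"
    using liouville_dirichlet_unique[OF _ _ _ _ W W1] by metis
  have "w x = radial_bubble \<theta> x" if "x \<in> closure ?A" for x
  proof -
    have x: "a \<le> norm x" "norm x \<le> b" "0 < norm x" using that a_pos by (auto simp: closure_shell)
    have "w x = w (norm x *\<^sub>R i)"
    proof -
      have "norm x *\<^sub>R i \<in> closure ?A" "norm x = norm (norm x *\<^sub>R i)"
        using x i by (simp_all add: closure_shell)
      then show ?thesis using rad that unfolding radial_on_def by blast
    qed
    also have "\<dots> = W (coord (norm x))" using x by (simp add: W_def radius_coord)
    also have "\<dots> = radial_bubble \<theta> x"
      using \<theta>(3)[of "coord (norm x)"] abs_coord_le_1[OF x(1,2)] by (simp add: radial_bubble_def abs_le_iff)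
    finally show ?thesis .
  qed
  moreover have "lam = lam_of \<theta>"
    using \<theta>(2) halfwidth_pos by (simp add: lam_of_def power_divide field_simps)
  ultimately show thesis using that \<theta>(1) by (auto simp: eq_on_def)
qed

section \<open>Total mass of a radial solution\<close>

lemma continuous_on_density:
  "continuous_on (closure (annulus a b))
    (\<lambda>x::'a::euclidean_space. exp (radial_bubble \<theta> x) / norm x ^ k)"
  using a_pos by (intro continuous_intros continuous_on_radial_bubble) (auto simp: closure_shell)

lemma bounded_shell: "bounded (annulus a b :: 'a::euclidean_space set)"
  by (rule bounded_subset[of "ball 0 b"]) (auto simp: annulus_def)

lemma set_integrable_density:
  assumes "H \<subseteq> annulus a b" "H \<in> sets lebesgue"
  shows "set_integrable lebesgue H (\<lambda>x::'a::euclidean_space. exp (radial_bubble \<theta> x) / norm x ^ k)"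
  by (rule set_integrable_lebesgue_compact[of "closure (annulus a b)"])
     (use assms closure_subset bounded_shell continuous_on_density in \<open>auto simp: compact_closure\<close>)

lemma annulus_lmeasurable: "(annulus a b :: 'a::euclidean_space set) \<in> lmeasurable"
  by (rule lmeasurable_open[OF bounded_shell open_annulus])

text \<open>The argument of type \<open>itself\<close> fixes the space over which the integral is taken, since the
  remaining data do not mention it.\<close>
definition mass :: "'a::euclidean_space itself \<Rightarrow> real \<Rightarrow> real" where
  "mass _ \<theta> = (LINT x:annulus a b|lebesgue. exp (radial_bubble \<theta> (x::'a)) / norm x ^ (2 * (n - 1)))"

lemma mass_nonneg: "0 \<le> mass TYPE('a::euclidean_space) \<theta>"
  unfolding mass_def set_lebesgue_integral_def
  by (intro Bochner_Integration.integral_nonneg) auto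

text \<open>The crude pointwise bound by the maximum suffices for the small solutions, where \<open>\<theta>\<close> stays
  bounded.\<close>
lemma mass_le:
  "mass TYPE('a::euclidean_space) \<theta>
    \<le> (cosh \<theta>)\<^sup>2 / a ^ (2 * (n - 1)) * measure lebesgue (annulus a b :: 'a set)"
proof -
  let ?C = "(cosh \<theta>)\<^sup>2 / a ^ (2 * (n - 1))"
  let ?A = "annulus a b :: 'a set"
  have fin: "?A \<in> sets lebesgue" "emeasure lebesgue ?A \<noteq> \<infinity>"
    using annulus_lmeasurable[where 'a='a] by (auto simp: fmeasurable_def)
  have "mass TYPE('a) \<theta> \<le> (LINT x:?A|lebesgue. ?C)"
    unfolding mass_def
  proof (rule set_integral_mono[OF set_integrable_density])
    show "set_integrable lebesgue ?A (\<lambda>x. ?C)"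
      by (rule set_integrable_lebesgue_compact[of "closure ?A"])
         (use fin closure_subset bounded_shell in \<open>auto simp: compact_closure\<close>)
    fix x assume "x \<in> ?A"
    then have x: "a < norm x" by (simp add: annulus_def)
    have "exp (radial_bubble \<theta> x) \<le> exp (bubble \<theta> 0)"
      by (simp add: radial_bubble_def bubble_le_max)
    then have "exp (radial_bubble \<theta> x) \<le> (cosh \<theta>)\<^sup>2"
      by (simp add: exp_bubble)
    then show "exp (radial_bubble \<theta> x) / norm x ^ (2 * (n - 1)) \<le> ?C"
      using x a_pos by (intro frac_le power_mono) auto
  qed (use fin in auto)
  also have "\<dots> = ?C * measure lebesgue ?A"
    using set_integral_const[OF fin, of ?C] by (simp only: real_scaleR_def mult.commute)
  finally show ?thesis .
qed

lemma radius_0_mem: "radius 0 \<in> {a<..<b}"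
  by (rule radius_mem) simp

text \<open>The derivative of the coordinate is largest in absolute value at the inner radius.\<close>
lemma abs_coord_le:
  assumes "radius 0 \<le> r"
  shows "\<bar>coord r\<bar> \<le> (r - radius 0) / (\<bar>speed\<bar> * a ^ (n - 1))"
proof (cases "r = radius 0")
  case False
  let ?r0 = "radius 0"
  have r0: "a < ?r0" using radius_0_mem by simp
  obtain z where z: "?r0 < z" "z < r" "coord r - coord ?r0 = (r - ?r0) * (1 / (speed * z ^ (n - 1)))"
    using MVT2[of ?r0 r coord "\<lambda>z. 1 / (speed * z ^ (n - 1))"] coord_deriv assms False r0 a_pos
    by force
  have "\<bar>coord r\<bar> = (r - ?r0) / (\<bar>speed\<bar> * z ^ (n - 1))"
    using z(3) coord_radius[of 0] assms z r0 a_pos by (simp add: abs_mult)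
  also have "\<dots> \<le> (r - ?r0) / (\<bar>speed\<bar> * a ^ (n - 1))"
    using z r0 a_pos assms speed_neq_0
    by (intro divide_left_mono mult_left_mono power_mono mult_pos_pos) auto
  finally show ?thesis .
qed (use coord_radius[of 0] in simp)

text \<open>In the shell of width \<open>1 / \<theta>\<close> outside the peak radius, \<open>\<theta> * coord\<close> stays below a constant \<open>K\<close>.
  There \<open>lam_of \<theta> * exp u\<close> is at least a multiple of \<open>\<theta>\<^sup>2\<close>, while the volume of the shell is at least
  a multiple of \<open>1 / \<theta>\<close>. The condition on \<open>\<theta>\<close> keeps the shell inside the annulus.\<close>
lemma mass_ge:
  assumes n: "n = DIM('a::euclidean_space)"
  obtains C where "0 < C"
    "\<And>\<theta>. 0 < \<theta> \<Longrightarrow> 1 / (b - radius 0) \<le> \<theta> \<Longrightarrow> C * \<theta> \<le> lam_of \<theta> * mass TYPE('a) \<theta>"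
proof -
  let ?A = "annulus a b :: 'a set"
  let ?r0 = "radius 0"
  have r0: "a < ?r0" "?r0 < b" using radius_0_mem by auto
  define K where "K = 1 / (\<bar>speed\<bar> * a ^ (n - 1))"
  define V where "V = unit_ball_vol (real DIM('a)) * ?r0 ^ (n - 1)"
  define C where "C = 2 / (halfwidth * cosh K)\<^sup>2 / b ^ (2 * (n - 1)) * V"
  have "0 < V" using r0 a_pos by (simp add: V_def)
  then have "0 < C" using halfwidth_pos a_pos a_less_b by (simp add: C_def)
  moreover have "C * \<theta> \<le> lam_of \<theta> * mass TYPE('a) \<theta>"
    if \<theta>: "0 < \<theta>" "1 / (b - ?r0) \<le> \<theta>" for \<theta>
  proof -
    define h where "h = 1 / \<theta>"
    define H where "H = (ball 0 (?r0 + h) - ball 0 ?r0 :: 'a set)"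
    define D where "D = (cosh \<theta> / cosh K)\<^sup>2 / b ^ (2 * (n - 1))"
    have h: "0 < h" "?r0 + h \<le> b" using \<theta> r0 by (auto simp: h_def field_simps)
    have HA: "H \<subseteq> ?A" using h r0 by (auto simp: H_def annulus_def)
    have "H \<in> lmeasurable" by (auto simp: H_def intro!: fmeasurable.Diff)
    then have fin: "H \<in> sets lebesgue" "emeasure lebesgue H \<noteq> \<infinity>"
      by (auto simp: fmeasurable_def)
    have "V * h \<le> measure lebesgue H"
      using content_ball_diff_ge[of ?r0 h, where 'a='a] r0 a_pos h
      by (simp add: V_def H_def n mult.assoc)
    moreover have "0 \<le> D" by (simp add: D_def)
    ultimately have "D * (V * h) \<le> D * measure lebesgue H" by (rule mult_left_mono)
    also have "\<dots> = (LINT x:H|lebesgue. D)"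
      using set_integral_const[OF fin, of D] by (simp only: real_scaleR_def mult.commute)
    also have "\<dots> \<le> (LINT x:H|lebesgue. exp (radial_bubble \<theta> x) / norm x ^ (2 * (n - 1)))"
    proof (rule set_integral_mono[OF _ set_integrable_density])
      show "set_integrable lebesgue H (\<lambda>x. D)"
        by (rule set_integrable_lebesgue_compact[of "closure ?A"])
           (use fin HA closure_subset bounded_shell in \<open>auto simp: compact_closure\<close>)
      fix x assume x: "x \<in> H"
      then have nx: "?r0 \<le> norm x" "norm x < ?r0 + h" by (auto simp: H_def)
      have "\<bar>coord (norm x)\<bar> \<le> h * K"
      proof -
        have "(norm x - ?r0) / (\<bar>speed\<bar> * a ^ (n - 1)) \<le> h / (\<bar>speed\<bar> * a ^ (n - 1))"
          using nx a_pos by (intro divide_right_mono) auto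
        then show ?thesis using abs_coord_le[OF nx(1)] by (simp add: K_def)
      qed
      then have "\<bar>\<theta> * coord (norm x)\<bar> \<le> K"
        using \<theta>(1) by (simp add: abs_mult h_def field_simps)
      then have "cosh (\<theta> * coord (norm x)) \<le> cosh K"
        using cosh_real_nonneg_le_iff[of "\<bar>\<theta> * coord (norm x)\<bar>" K] by simp
      then have "(cosh \<theta> / cosh K)\<^sup>2 \<le> (cosh \<theta> / cosh (\<theta> * coord (norm x)))\<^sup>2"
        by (intro power_mono divide_left_mono) auto
      then have "(cosh \<theta> / cosh K)\<^sup>2 \<le> exp (radial_bubble \<theta> x)"
        by (simp add: radial_bubble_def exp_bubble)
      then show "D \<le> exp (radial_bubble \<theta> x) / norm x ^ (2 * (n - 1))"
        unfolding D_def using nx h r0 a_pos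
        by (intro frac_le power_mono zero_less_power) auto
    qed (use HA fin in auto)
    also have "\<dots> \<le> mass TYPE('a) \<theta>"
      unfolding mass_def set_lebesgue_integral_def
    proof (rule integral_mono)
      show "integrable lebesgue (\<lambda>x. indicator H x *\<^sub>R (exp (radial_bubble \<theta> x) / norm x ^ (2 * (n - 1))))"
        using set_integrable_density[OF HA fin(1)] by (simp add: set_integrable_def)
      show "integrable lebesgue (\<lambda>x. indicator ?A x *\<^sub>R (exp (radial_bubble \<theta> x) / norm x ^ (2 * (n - 1))))"
        using set_integrable_density[OF subset_refl] annulus_lmeasurable[where 'a='a]
        by (auto simp: set_integrable_def fmeasurable_def)
    qed (use HA in \<open>auto simp: indicator_def\<close>)
    finally have "lam_of \<theta> * (D * (V * h)) \<le> lam_of \<theta> * mass TYPE('a) \<theta>"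
      by (rule mult_left_mono) (simp add: lam_of_def)
    moreover have "lam_of \<theta> * (D * (V * h)) = C * \<theta>"
      using \<theta>(1) by (simp add: lam_of_def D_def C_def h_def load_def power_divide
          power_mult_distrib power2_eq_square mult_ac)
    ultimately show ?thesis by simp
  qed
  ultimately show thesis using that by blast
qed

section \<open>Peak, rescaling and tent-shaped limit\<close>

lemma radius_0_point:
  obtains x :: "'a::euclidean_space" where "x \<in> annulus a b" "coord (norm x) = 0"
proof -
  obtain x :: 'a where "norm x = radius 0"
    using vector_choose_size[of "radius 0"] radius_0_mem a_pos by auto
  then show thesis using that[of x] radius_0_mem coord_radius[of 0] by (auto simp: annulus_def)
qed

lemma radial_bubble_bounds:
  assumes "x \<in> closure (annulus a b)"
  shows "0 \<le> radial_bubble \<theta> (x::'a::euclidean_space)" "radial_bubble \<theta> x \<le> 2 * ln (cosh \<theta>)"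
  using assms bubble_nonneg[OF abs_coord_le_1] bubble_le_max[of \<theta>]
  by (auto simp: radial_bubble_def closure_shell bubble_0)

lemma Linf_norm_radial_bubble:
  "Linf_norm (annulus a b) (radial_bubble \<theta> :: 'a::euclidean_space \<Rightarrow> real) = 2 * ln (cosh \<theta>)"
proof -
  obtain x :: 'a where x: "x \<in> annulus a b" "coord (norm x) = 0" by (rule radius_0_point)
  have cl: "y \<in> annulus a b \<Longrightarrow> y \<in> closure (annulus a b)" for y :: 'a
    using closure_subset by blast
  show ?thesis
  proof (rule Linf_norm_attained[OF open_annulus _ _ x(1)])
    show "continuous_on (annulus a b) (radial_bubble \<theta> :: 'a \<Rightarrow> real)"
      using continuous_on_subset[OF continuous_on_radial_bubble closure_subset] .
    show "\<bar>radial_bubble \<theta> y\<bar> \<le> 2 * ln (cosh \<theta>)" if "y \<in> annulus a b" for y :: 'a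
      using radial_bubble_bounds[OF cl[OF that], of \<theta>] by simp
    show "\<bar>radial_bubble \<theta> x\<bar> = 2 * ln (cosh \<theta>)"
      using x(2) by (simp add: radial_bubble_def bubble_0 cosh_real_ge_1)
  qed
qed

text \<open>The length \<open>\<delta>\<close> that solves \<open>lam * \<delta>\<^sup>2 * exp (max u) = 1\<close>; the factors \<open>cosh \<theta>\<close> in \<open>lam\<close> and in the
  maximum cancel.\<close>
definition scale :: "real \<Rightarrow> real" where
  "scale \<theta> = halfwidth / (sqrt 2 * \<theta>)"

lemma scale_pos: "0 < \<theta> \<Longrightarrow> 0 < scale \<theta>"
  using halfwidth_pos by (simp add: scale_def)

lemma scale_normalised:
  assumes "0 < \<theta>"
  shows "lam_of \<theta> * (scale \<theta>)\<^sup>2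
    * exp (Linf_norm (annulus a b) (radial_bubble \<theta> :: 'a::euclidean_space \<Rightarrow> real)) = 1"
proof -
  have "exp (2 * ln (cosh \<theta>)) = (cosh \<theta>)\<^sup>2"
    using exp_bubble[of \<theta> 0] by (simp add: bubble_0)
  then show ?thesis
    using assms halfwidth_pos
    by (simp add: Linf_norm_radial_bubble lam_of_def scale_def load_def power_divide power_mult_distrib)
qed

lemma mem_rescaled_domain_iff:
  assumes "0 < d"
  shows "t \<in> rescaled_domain a b n d \<longleftrightarrow> \<bar>d * t\<bar> < halfwidth"
  using assms unfolding rescaled_domain_def halfwidth_def
  by (auto simp: field_simps abs_less_iff)

text \<open>A shift by \<open>scale \<theta> * t\<close> from the midpoint changes \<open>\<theta> * coord\<close> by exactly \<open>t / sqrt 2\<close>, so the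
  parameter \<open>\<theta>\<close> disappears from the rescaled function.\<close>
lemma rescaled_radial_bubble:
  assumes n: "n = DIM('a::euclidean_space)" and \<theta>: "0 < \<theta>"
    and t: "t \<in> rescaled_domain a b n (scale \<theta>)"
  shows "rescaled a b (scale \<theta>) (radial_bubble \<theta> :: 'a \<Rightarrow> real) t
    = ln (4 * exp (sqrt 2 * t) / (1 + exp (sqrt 2 * t))\<^sup>2)"
proof -
  define \<tau> where "\<tau> = scale \<theta> * t / halfwidth"
  have "\<bar>\<tau>\<bar> < 1"
    using t mem_rescaled_domain_iff[OF scale_pos[OF \<theta>]] halfwidth_pos by (simp add: \<tau>_def abs_divide)
  then have \<tau>: "\<tau> \<in> {-1..1}" by (auto simp: abs_less_iff)
  have "(scale \<theta> * t + (a powr (2 - real n) + b powr (2 - real n)) / 2) powr (1 / (2 - real n)) = radius \<tau>"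
    using halfwidth_pos by (simp add: radius_def \<tau>_def mid_def add.commute)
  moreover have "radial_profile (radial_bubble \<theta> :: 'a \<Rightarrow> real) (radius \<tau>) = bubble \<theta> \<tau>"
    using radial_profile_norm[of "radial_bubble \<theta> :: 'a \<Rightarrow> real" "\<lambda>r. bubble \<theta> (coord r)" "radius \<tau>"]
      radius_pos[OF \<tau>] coord_radius[OF \<tau>] by (simp add: radial_bubble_def)
  moreover have "bubble \<theta> \<tau> - 2 * ln (cosh \<theta>) = - 2 * ln (cosh (\<theta> * \<tau>))"
    by (simp add: bubble_def ln_div)
  moreover have "\<theta> * \<tau> = t / sqrt 2"
    using \<theta> halfwidth_pos by (simp add: \<tau>_def scale_def)
  ultimately show ?thesis
    by (simp add: rescaled_def Linf_norm_radial_bubble ln_sigmoid_eq_ln_cosh flip: n)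
qed

lemma green_midpoint:
  assumes "a \<le> r" "r \<le> b"
  shows "green (b powr (2 - real n)) (a powr (2 - real n)) (r powr (2 - real n)) mid
    = halfwidth * (1 - \<bar>coord r\<bar>) / 2"
proof -
  have s: "r powr (2 - real n) = mid + halfwidth * coord r"
    using halfwidth_pos by (simp add: coord_def)
  show ?thesis
    unfolding green_def s mid_bounds[symmetric]
    using halfwidth_pos by (auto simp: mult_le_0_iff field_simps)
qed

lemma scale_radial_bubble_tent:
  assumes "0 < \<theta>" "a \<le> norm x" "norm x \<le> b"
  shows "\<bar>scale \<theta> * radial_bubble \<theta> x - 2 * sqrt 2 *
      green (b powr (2 - real n)) (a powr (2 - real n)) (norm x powr (2 - real n)) mid\<bar>
    \<le> 2 * ln 2 * scale \<theta>"
proof -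
  have eq: "2 * sqrt 2 * (halfwidth * (1 - \<bar>coord (norm x)\<bar>) / 2)
      = scale \<theta> * (2 * \<bar>\<theta>\<bar> * (1 - \<bar>coord (norm x)\<bar>))"
  proof -
    have "scale \<theta> = sqrt 2 * halfwidth / (2 * \<theta>)"
      using assms(1) by (simp add: scale_def field_simps)
    then show ?thesis using assms(1) by (simp add: field_simps)
  qed
  have "scale \<theta> * radial_bubble \<theta> x - 2 * sqrt 2 *
      green (b powr (2 - real n)) (a powr (2 - real n)) (norm x powr (2 - real n)) mid
    = scale \<theta> * (bubble \<theta> (coord (norm x)) - 2 * \<bar>\<theta>\<bar> * (1 - \<bar>coord (norm x)\<bar>))"
    unfolding green_midpoint[OF assms(2,3)] radial_bubble_def eq by (simp only: right_diff_distrib)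
  then show ?thesis
    using mult_left_mono[OF bubble_tent[of \<theta> "coord (norm x)"] less_imp_le[OF scale_pos[OF assms(1)]]]
      scale_pos[OF assms(1)] by (simp add: abs_mult mult_ac)
qed

end

section \<open>Existence, multiplicity and asymptotics\<close>

theorem theorem7:
  fixes a b :: real and N :: nat and A :: "(real ^ 'n) set"
  assumes N_def: "N = CARD('n)" and N_ge: "N \<ge> 3"
    and "0 < a" and "a < b"
    and A_def: "A = annulus a b"
  shows "\<exists>lam_star > 0.
    (\<forall>lam > lam_star. \<not> (\<exists>v :: real ^ 'n \<Rightarrow> real. radial_solution a b lam v)) \<and>
    (\<exists>v :: real ^ 'n \<Rightarrow> real. radial_solution a b lam_star v \<and>
       (\<forall>w. radial_solution a b lam_star w \<longrightarrow> eq_on (closure A) w v)) \<and>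
    (\<exists>(u :: real \<Rightarrow> real ^ 'n \<Rightarrow> real) (U :: real \<Rightarrow> real ^ 'n \<Rightarrow> real) (\<delta> :: real \<Rightarrow> real).
       (\<forall>lam. 0 < lam \<and> lam < lam_star \<longrightarrow>
          radial_solution a b lam (u lam) \<and> radial_solution a b lam (U lam) \<and>
          \<not> eq_on (closure A) (u lam) (U lam) \<and>
          (\<forall>w. radial_solution a b lam w \<longrightarrow>
             eq_on (closure A) w (u lam) \<or> eq_on (closure A) w (U lam)) \<and>
          (\<forall>x \<in> closure A. u lam x \<le> U lam x) \<and>
          \<delta> lam > 0 \<and> lam * (\<delta> lam)\<^sup>2 * exp (Linf_norm A (U lam)) = 1) \<and>
       ((\<lambda>lam. lam * (LINT x:A|lebesgue. exp (u lam x) / norm x ^ (2 * (N - 1)))) \<longlongrightarrow> 0)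
         (at_right 0) \<and>
       filterlim (\<lambda>lam. lam * (LINT x:A|lebesgue. exp (U lam x) / norm x ^ (2 * (N - 1))))
         at_top (at_right 0) \<and>
       uniform_limit (closure A) u (\<lambda>x. 0) (at_right 0) \<and>
       (\<delta> \<longlongrightarrow> 0) (at_right 0) \<and>
       C1_loc_limit (\<lambda>lam. rescaled_domain a b N (\<delta> lam))
         (\<lambda>lam. rescaled a b (\<delta> lam) (U lam))
         (\<lambda>t. ln (4 * exp (sqrt 2 * t) / (1 + exp (sqrt 2 * t))\<^sup>2))
         (at_right 0) \<and>
       uniform_limit (closure A) (\<lambda>lam x. \<delta> lam * U lam x)
         (\<lambda>x. 2 * sqrt 2 *
            green (b powr (2 - real N)) (a powr (2 - real N)) (norm x powr (2 - real N))
              ((a powr (2 - real N) + b powr (2 - real N)) / 2))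
         (at_right 0))"
proof -
  interpret annular_shell a b N
    using assms by unfold_locales auto
  have dim: "N = DIM(real ^ 'n)" using N_def by simp
  obtain t \<theta>1 \<theta>2 where t: "t > 0"
    and load_le: "\<And>\<theta>. \<theta> > 0 \<Longrightarrow> load \<theta> \<le> load t"
    and load_max: "\<And>\<theta>. \<theta> > 0 \<Longrightarrow> load \<theta> = load t \<Longrightarrow> \<theta> = t"
    and branches: "\<And>\<mu>. 0 < \<mu> \<Longrightarrow> \<mu> < load t \<Longrightarrow>
        0 < \<theta>1 \<mu> \<and> \<theta>1 \<mu> < \<theta>2 \<mu> \<and> load (\<theta>1 \<mu>) = \<mu> \<and> load (\<theta>2 \<mu>) = \<mu>"
    and branches_only: "\<And>\<mu> \<theta>. 0 < \<mu> \<Longrightarrow> \<mu> < load t \<Longrightarrow> \<theta> > 0 \<Longrightarrow> load \<theta> = \<mu> \<Longrightarrow>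
        \<theta> = \<theta>1 \<mu> \<or> \<theta> = \<theta>2 \<mu>"
    and \<theta>1_lim: "(\<theta>1 \<longlongrightarrow> 0) (at_right 0)" and \<theta>2_lim: "filterlim \<theta>2 at_top (at_right 0)"
    using load_branches by blast
    \<comment> \<open>\<open>\<mu> lam\<close> is the value of \<open>load\<close> required by \<open>lam\<close>, that is \<open>lam_of \<theta> = lam\<close> iff
    \<open>load \<theta> = \<mu> lam\<close>; \<open>p\<close> and \<open>q\<close> are the parameters of the minimal and the large solution.\<close>
define \<mu> where "\<mu> lam = halfwidth * sqrt (lam / 2)" for lam
  define p where "p lam = \<theta>1 (\<mu> lam)" for lam
  define q where "q lam = \<theta>2 (\<mu> lam)" for lam
  define lam_star where "lam_star = lam_of t"
  have lam_star_pos: "0 < lam_star"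
    using load_pos[OF t] halfwidth_pos by (simp add: lam_star_def lam_of_def)
  have \<mu>_lam_of: "\<mu> (lam_of \<theta>) = load \<theta>" if "\<theta> > 0" for \<theta>
    using halfwidth_pos load_pos[OF that] by (simp add: \<mu>_def lam_of_def)
  have lam_of_eq: "lam_of \<theta> = lam" if "load \<theta> = \<mu> lam" "0 < lam" for \<theta> lam
    using that halfwidth_pos by (simp add: lam_of_def \<mu>_def)
  have \<mu>_mono: "\<mu> x < \<mu> y" if "x < y" for x y
    using that halfwidth_pos by (simp add: \<mu>_def)
  have \<mu>_pos: "0 < \<mu> lam" if "0 < lam" for lam
    using that halfwidth_pos by (simp add: \<mu>_def)
  have \<mu>_star: "\<mu> lam_star = load t" by (simp add: lam_star_def \<mu>_lam_of t)
  have pq: "0 < p lam" "p lam < q lam" "lam_of (p lam) = lam" "lam_of (q lam) = lam"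
    if "0 < lam" "lam < lam_star" for lam
  proof -
    have "0 < p lam \<and> p lam < q lam \<and> load (p lam) = \<mu> lam \<and> load (q lam) = \<mu> lam"
      unfolding p_def q_def
      using branches[OF \<mu>_pos[OF that(1)]] \<mu>_mono[OF that(2)] \<mu>_star by simp
    then show "0 < p lam" "p lam < q lam" "lam_of (p lam) = lam" "lam_of (q lam) = lam"
      using lam_of_eq[OF _ that(1)] by blast+
  qed
  have pq_only: "\<theta> = p lam \<or> \<theta> = q lam"
    if "0 < lam" "lam < lam_star" "0 < \<theta>" "lam = lam_of \<theta>" for lam \<theta>
    unfolding p_def q_def
  proof (rule branches_only[OF \<mu>_pos[OF that(1)] _ that(3)])
    show "\<mu> lam < load t" using \<mu>_mono[OF that(2)] \<mu>_star by simp
    show "load \<theta> = \<mu> lam" using \<mu>_lam_of[OF that(3)] that(4) by simp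
  qed
  have range: "\<forall>\<^sub>F lam in at_right 0. 0 < lam \<and> lam < lam_star"
    using eventually_at_right[OF lam_star_pos] lam_star_pos by auto
  have "filterlim \<mu> (at_right 0) (at_right 0)"
    unfolding filterlim_at
  proof
    have "(\<mu> \<longlongrightarrow> halfwidth * sqrt (0 / 2)) (at_right 0)"
      unfolding \<mu>_def by (intro tendsto_intros) simp
    then show "(\<mu> \<longlongrightarrow> 0) (at_right 0)" by simp
    show "\<forall>\<^sub>F lam in at_right 0. \<mu> lam \<in> {0<..} \<and> \<mu> lam \<noteq> 0"
      using range by eventually_elim (use \<mu>_pos in force)
  qed
  then have p_lim: "(p \<longlongrightarrow> 0) (at_right 0)" and q_lim: "filterlim q at_top (at_right 0)"
    unfolding p_def q_def using filterlim_compose[OF \<theta>1_lim] filterlim_compose[OF \<theta>2_lim] by auto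
  define u :: "real \<Rightarrow> real ^ 'n \<Rightarrow> real" where "u lam = radial_bubble (p lam)" for lam
  define U :: "real \<Rightarrow> real ^ 'n \<Rightarrow> real" where "U lam = radial_bubble (q lam)" for lam
  define \<delta> where "\<delta> lam = scale (q lam)" for lam
  have sol: "radial_solution a b (lam_of \<theta>) (radial_bubble \<theta> :: real ^ 'n \<Rightarrow> real)" for \<theta>
    by (rule radial_solution_radial_bubble[OF dim])
  have \<delta>_lim: "(\<delta> \<longlongrightarrow> 0) (at_right 0)"
  proof -
    have "((\<lambda>lam. halfwidth / sqrt 2 * inverse (q lam)) \<longlongrightarrow> halfwidth / sqrt 2 * 0) (at_right 0)"
      by (intro tendsto_intros tendsto_inverse_0_at_top[OF q_lim]) simp
    moreover have "\<delta> = (\<lambda>lam. halfwidth / sqrt 2 * inverse (q lam))"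
      by (simp add: fun_eq_iff \<delta>_def scale_def divide_inverse)
    ultimately show ?thesis by simp
  qed
  have \<delta>_pos: "\<forall>\<^sub>F lam in at_right 0. 0 < \<delta> lam"
    using range by eventually_elim (use pq in \<open>auto simp: \<delta>_def intro!: scale_pos intro: less_trans\<close>)

  have none: "\<not> radial_solution a b lam v" if lam: "lam > lam_star" for lam and v :: "real ^ 'n \<Rightarrow> real"
  proof
    assume v: "radial_solution a b lam v"
    have "0 < lam" using lam lam_star_pos by simp
    then obtain \<theta> where "0 < \<theta>" "lam = lam_of \<theta>"
      using radial_solution_imp_radial_bubble[OF dim _ v] by metis
    then show False using \<mu>_mono[OF lam] load_le[of \<theta>] by (simp add: \<mu>_star \<mu>_lam_of)
  qed
  have unique: "eq_on (closure A) w (radial_bubble t)"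
    if w: "radial_solution a b lam_star w" for w :: "real ^ 'n \<Rightarrow> real"
  proof -
    obtain \<theta> where \<theta>: "0 < \<theta>" "lam_star = lam_of \<theta>" "eq_on (closure A) w (radial_bubble \<theta>)"
      using radial_solution_imp_radial_bubble[OF dim lam_star_pos w] A_def by metis
    then have "\<theta> = t" using load_max[OF \<theta>(1)] \<mu>_lam_of[OF \<theta>(1)] \<mu>_star by metis
    then show ?thesis using \<theta>(3) by simp
  qed
  have two: "radial_solution a b lam (u lam) \<and> radial_solution a b lam (U lam) \<and>
          \<not> eq_on (closure A) (u lam) (U lam) \<and>
          (\<forall>w. radial_solution a b lam w \<longrightarrow>
             eq_on (closure A) w (u lam) \<or> eq_on (closure A) w (U lam)) \<and>
          (\<forall>x \<in> closure A. u lam x \<le> U lam x) \<and>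
          \<delta> lam > 0 \<and> lam * (\<delta> lam)\<^sup>2 * exp (Linf_norm A (U lam)) = 1"
    if lam: "0 < lam" "lam < lam_star" for lam
  proof (intro conjI allI impI ballI)
    note pq = pq[OF lam]
    show "radial_solution a b lam (u lam)" "radial_solution a b lam (U lam)"
      using sol[of "p lam"] sol[of "q lam"] pq by (simp_all add: u_def U_def)
    show "\<not> eq_on (closure A) (u lam) (U lam)"
    proof -
      obtain x :: "real ^ 'n" where x: "x \<in> annulus a b" "coord (norm x) = 0"
        by (rule radius_0_point)
      have "u lam x \<noteq> U lam x"
        using x(2) pq(1,2) by (simp add: u_def U_def radial_bubble_def bubble_0)
      then show ?thesis
        using x(1) closure_subset[of A] unfolding eq_on_def A_def by blast
    qed
    show "eq_on (closure A) w (u lam) \<or> eq_on (closure A) w (U lam)"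
      if "radial_solution a b lam w" for w
      using radial_solution_imp_radial_bubble[OF dim lam(1) that] pq_only[OF lam]
      unfolding u_def U_def A_def by metis
    show "u lam x \<le> U lam x" if "x \<in> closure A" for x
      using that pq abs_coord_le_1[of "norm x"]
      by (auto simp: u_def U_def radial_bubble_def A_def closure_shell intro!: bubble_mono)
    show "\<delta> lam > 0" using pq by (simp add: \<delta>_def scale_pos)
    show "lam * (\<delta> lam)\<^sup>2 * exp (Linf_norm A (U lam)) = 1"
      using scale_normalised[of "q lam", where 'a = "real ^ 'n"] pq by (simp add: A_def U_def \<delta>_def)
  qed
  have mass_u: "((\<lambda>lam. lam * (LINT x:A|lebesgue. exp (u lam x) / norm x ^ (2 * (N - 1)))) \<longlongrightarrow> 0)
         (at_right 0)"
  proof (rule real_tendsto_sandwich)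
    let ?c = "\<lambda>lam. lam * ((cosh (p lam))\<^sup>2 / a ^ (2 * (N - 1)) * measure lebesgue A)"
    have m: "(LINT x:A|lebesgue. exp (u lam x) / norm x ^ (2 * (N - 1))) = mass TYPE(real ^ 'n) (p lam)"
      for lam by (simp add: mass_def A_def u_def)
    show "\<forall>\<^sub>F lam in at_right 0. 0 \<le> lam * (LINT x:A|lebesgue. exp (u lam x) / norm x ^ (2 * (N - 1)))"
      unfolding m using range by eventually_elim (auto intro!: mult_nonneg_nonneg mass_nonneg)
    show "\<forall>\<^sub>F lam in at_right 0. lam * (LINT x:A|lebesgue. exp (u lam x) / norm x ^ (2 * (N - 1))) \<le> ?c lam"
      unfolding m unfolding A_def
      using range by eventually_elim (intro mult_left_mono mass_le; simp)
    have "(?c \<longlongrightarrow> 0 * ((cosh 0)\<^sup>2 / a ^ (2 * (N - 1)) * measure lebesgue A)) (at_right 0)"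
      using \<open>0 < a\<close> by (intro tendsto_intros p_lim) auto
    then show "(?c \<longlongrightarrow> 0) (at_right 0)" by simp
  qed simp
  have mass_U: "filterlim (\<lambda>lam. lam * (LINT x:A|lebesgue. exp (U lam x) / norm x ^ (2 * (N - 1))))
         at_top (at_right 0)"
  proof -
    obtain C where C: "0 < C" "\<And>\<theta>. 0 < \<theta> \<Longrightarrow> 1 / (b - radius 0) \<le> \<theta> \<Longrightarrow>
        C * \<theta> \<le> lam_of \<theta> * mass TYPE(real ^ 'n) \<theta>"
      using mass_ge[OF dim] by blast
    have "filterlim (\<lambda>lam. C * q lam) at_top (at_right 0)"
      by (rule filterlim_tendsto_pos_mult_at_top[OF tendsto_const C(1) q_lim])
    moreover have "\<forall>\<^sub>F lam in at_right 0. 1 / (b - radius 0) \<le> q lam"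
      using q_lim by (simp add: filterlim_at_top)
    with range have "\<forall>\<^sub>F lam in at_right 0. C * q lam
        \<le> lam * (LINT x:A|lebesgue. exp (U lam x) / norm x ^ (2 * (N - 1)))"
    proof eventually_elim
      case (elim lam)
      then show ?case
        using C(2)[of "q lam"] pq[of lam] unfolding mass_def U_def A_def by simp
    qed
    ultimately show ?thesis by (rule filterlim_at_top_mono)
  qed
  have u_lim: "uniform_limit (closure A) u (\<lambda>x. 0) (at_right 0)"
  proof (rule uniform_limitI)
    fix e :: real assume "0 < e"
    have "((\<lambda>lam. 2 * ln (cosh (p lam))) \<longlongrightarrow> 2 * ln (cosh 0)) (at_right 0)"
      by (intro tendsto_intros p_lim) auto
    then have "\<forall>\<^sub>F lam in at_right 0. 2 * ln (cosh (p lam)) < e"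
      using order_tendstoD(2) \<open>0 < e\<close> by fastforce
    then show "\<forall>\<^sub>F lam in at_right 0. \<forall>x\<in>closure A. dist (u lam x) 0 < e"
    proof eventually_elim
      case (elim lam)
      then show ?case
        using radial_bubble_bounds[of _ "p lam", where 'a = "real ^ 'n"] by (force simp: u_def A_def)
    qed
  qed
  have rescaled_lim: "C1_loc_limit (\<lambda>lam. rescaled_domain a b N (\<delta> lam))
         (\<lambda>lam. rescaled a b (\<delta> lam) (U lam))
         (\<lambda>t. ln (4 * exp (sqrt 2 * t) / (1 + exp (sqrt 2 * t))\<^sup>2))
         (at_right 0)"
  proof (rule C1_loc_limit_eventually_eq[OF _ _ sigmoid_C1])
    show "open (rescaled_domain a b N (\<delta> lam))" for lam
      by (simp add: rescaled_domain_def)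
    show "\<forall>\<^sub>F lam in at_right 0. \<forall>t\<in>rescaled_domain a b N (\<delta> lam). rescaled a b (\<delta> lam) (U lam) t
        = ln (4 * exp (sqrt 2 * t) / (1 + exp (sqrt 2 * t))\<^sup>2)"
      using range
    proof eventually_elim
      case (elim lam)
      then have "0 < q lam" using pq[of lam] by auto
      then show ?case using rescaled_radial_bubble[OF dim] by (simp add: \<delta>_def U_def)
    qed
    fix K :: "real set" assume "compact K"
    then obtain B where B: "\<And>t. t \<in> K \<Longrightarrow> \<bar>t\<bar> \<le> B"
      using compact_imp_bounded bounded_iff[of K] by auto
    have "((\<lambda>lam. \<delta> lam * B) \<longlongrightarrow> 0 * B) (at_right 0)" by (intro tendsto_intros \<delta>_lim)
    then have "\<forall>\<^sub>F lam in at_right 0. \<delta> lam * B < halfwidth"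
      using order_tendstoD(2) halfwidth_pos by fastforce
    with \<delta>_pos show "\<forall>\<^sub>F lam in at_right 0. K \<subseteq> rescaled_domain a b N (\<delta> lam)"
    proof eventually_elim
      case (elim lam)
      show ?case
      proof
        fix t assume "t \<in> K"
        then have "\<delta> lam * \<bar>t\<bar> \<le> \<delta> lam * B" using B elim by (intro mult_left_mono) auto
        also have "\<dots> < halfwidth" using elim by simp
        finally show "t \<in> rescaled_domain a b N (\<delta> lam)"
          using elim by (simp add: mem_rescaled_domain_iff abs_mult)
      qed
    qed
  qed
  have green_lim: "uniform_limit (closure A) (\<lambda>lam x. \<delta> lam * U lam x)
         (\<lambda>x. 2 * sqrt 2 *
            green (b powr (2 - real N)) (a powr (2 - real N)) (norm x powr (2 - real N)) mid)
         (at_right 0)"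
  proof (rule uniform_limitI)
    fix e :: real assume "0 < e"
    have "((\<lambda>lam. 2 * ln 2 * \<delta> lam) \<longlongrightarrow> 2 * ln 2 * 0) (at_right 0)" by (intro tendsto_intros \<delta>_lim)
    then have "\<forall>\<^sub>F lam in at_right 0. 2 * ln 2 * \<delta> lam < e"
      using order_tendstoD(2) \<open>0 < e\<close> by fastforce
    with range show "\<forall>\<^sub>F lam in at_right 0. \<forall>x\<in>closure A. dist (\<delta> lam * U lam x) (2 * sqrt 2 *
            green (b powr (2 - real N)) (a powr (2 - real N)) (norm x powr (2 - real N)) mid) < e"
    proof eventually_elim
      case (elim lam)
      then have "0 < q lam" using pq[of lam] by auto
      from scale_radial_bubble_tent[OF this] elim(2) show ?case
        by (force simp: dist_real_def \<delta>_def U_def A_def closure_shell)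
    qed
  qed
  show ?thesis
  proof (intro exI[of _ lam_star] conjI)
    show "\<exists>v :: real ^ 'n \<Rightarrow> real. radial_solution a b lam_star v \<and>
       (\<forall>w. radial_solution a b lam_star w \<longrightarrow> eq_on (closure A) w v)"
      using sol[of t] unique by (auto simp: lam_star_def)
  qed (use lam_star_pos none two mass_u mass_U u_lim \<delta>_lim rescaled_lim
      green_lim[unfolded mid_def] in blast)+
qed

end
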